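(* Let $(F_k,g_F)$ be a pseudo-Riemannian manifold of dimension $k\ge2$ that is Einstein with constant $\nu$, and let $u:\mathbb{R}_+\to(0,\infty)$ be a smooth function, $\mathbb{R}_+=(0,\infty)$. Fix a choice of sign $\pm$ and let $\lambda\in\mathbb{R}$. Then $\mathbb{R}_+\times\mathbb{R}\times F_k$, with coordinates $(s,y)\in\mathbb{R}_+\times\mathbb{R}$, furnished with the metric $$g=s^{\frac1k-1}\left[\frac{1}{4\sqrt{s}\,u^2(\sqrt s)}\,ds^2\pm4\sqrt{s}\,u^2(\sqrt s)\,dy^2\right]+s^{\frac2k}g_F,$$ is Einstein with constant $\lambda$ if and only if there is a constant $C\in\mathbb{R}$ such that for all $r>0$ $$u^2(r)=\lambda\left(1-\Big(1+\frac2k\Big)^2\right)^{-1}r^{1+\frac2k}+\nu\left(1-\Big(1-\frac2k\Big)^2\right)^{-1}r^{1-\frac2k}+C\,\frac1r$$ (so $\lambda$ and $C$ must be such that the right-hand side is positive).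
   Context: A pseudo-Riemannian manifold $(N,h)$ is called Einstein with constant $\lambda$ if $\mathrm{Ric}_h=\lambda h$ ($\mathrm{Ric}$ with the sign convention making round spheres have positive Ricci curvature). $u^2(r)$ means $(u(r))^2$. Metrics on the factors are identified with their pullbacks to the product. *)

theory Defs
  imports "HOL-Analysis.Analysis"
begin

section \<open>Smooth maps between open subsets of Euclidean spaces\<close>

text \<open>Only meant for open \<open>S\<close>. In finite dimension, \<open>f\<close> is of class \<open>C\<^sup>n\<^sup>+\<^sup>1\<close> iff it is differentiable
  and all its directional derivatives are of class \<open>C\<^sup>n\<close>.\<close>

primrec Ck_on :: "nat \<Rightarrow> 'e::euclidean_space set \<Rightarrow> ('e \<Rightarrow> 'b::real_normed_vector) \<Rightarrow> bool" where
  "Ck_on 0 S f \<longleftrightarrow> continuous_on S f"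
| "Ck_on (Suc n) S f \<longleftrightarrow>
     (\<forall>x\<in>S. f differentiable (at x)) \<and> (\<forall>v. Ck_on n S (\<lambda>x. frechet_derivative f (at x) v))"

definition smooth_on :: "'e::euclidean_space set \<Rightarrow> ('e \<Rightarrow> 'b::real_normed_vector) \<Rightarrow> bool" where
  "smooth_on S f \<longleftrightarrow> (\<forall>n. Ck_on n S f)"


section \<open>Smooth manifolds\<close>

text \<open>A manifold is given by its topology and an indexed smooth atlas modelled on \<open>'e\<close>, so that its
  dimension is \<open>DIM('e)\<close>. The chart \<open>chart M i\<close> is only relevant on \<open>chart_dom M i\<close>.\<close>

record ('a, 'e, 'i) manifold =
  mtopology :: "'a topology"
  indices :: "'i set"
  chart_dom :: "'i \<Rightarrow> 'a set"
  chart :: "'i \<Rightarrow> 'a \<Rightarrow> 'e"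

definition chart_image :: "('a, 'e, 'i) manifold \<Rightarrow> 'i \<Rightarrow> 'e set" where
  "chart_image M i = chart M i ` chart_dom M i"

definition transition :: "('a, 'e, 'i) manifold \<Rightarrow> 'i \<Rightarrow> 'i \<Rightarrow> 'e \<Rightarrow> 'e" where
  "transition M i j = chart M j \<circ> the_inv_into (chart_dom M i) (chart M i)"

definition transition_dom :: "('a, 'e, 'i) manifold \<Rightarrow> 'i \<Rightarrow> 'i \<Rightarrow> 'e set" where
  "transition_dom M i j = chart M i ` (chart_dom M i \<inter> chart_dom M j)"

text \<open>Manifolds are nonempty (otherwise every metric would be Einstein with every constant), but need
  not be connected.\<close>

definition smooth_manifold :: "('a, 'e::euclidean_space, 'i) manifold \<Rightarrow> bool" where
  "smooth_manifold M \<longleftrightarrow>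
     topspace (mtopology M) \<noteq> {} \<and>
     Hausdorff_space (mtopology M) \<and>
     second_countable (mtopology M) \<and>
     (\<Union>i\<in>indices M. chart_dom M i) = topspace (mtopology M) \<and>
     (\<forall>i\<in>indices M. openin (mtopology M) (chart_dom M i) \<and> open (chart_image M i) \<and>
        homeomorphic_map (subtopology (mtopology M) (chart_dom M i))
          (top_of_set (chart_image M i)) (chart M i)) \<and>
     (\<forall>i\<in>indices M. \<forall>j\<in>indices M. smooth_on (transition_dom M i j) (transition M i j))"

definition open_submanifold :: "'e::euclidean_space set \<Rightarrow> ('e, 'e, unit) manifold" where
  "open_submanifold S =
     \<lparr>mtopology = top_of_set S, indices = {()}, chart_dom = (\<lambda>_. S), chart = (\<lambda>_ x. x)\<rparr>"

definition prod_manifold ::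
  "('a, 'e, 'i) manifold \<Rightarrow> ('b, 'f, 'j) manifold \<Rightarrow> ('a \<times> 'b, 'e \<times> 'f, 'i \<times> 'j) manifold" where
  "prod_manifold M N =
     \<lparr>mtopology = prod_topology (mtopology M) (mtopology N),
      indices = indices M \<times> indices N,
      chart_dom = (\<lambda>(i, j). chart_dom M i \<times> chart_dom N j),
      chart = (\<lambda>(i, j). map_prod (chart M i) (chart N j))\<rparr>"


section \<open>Pseudo-Riemannian metrics\<close>

text \<open>A metric is given by its local representations: \<open>g i x v w\<close> is the value at the point with
  coordinates \<open>x\<close> in the chart \<open>i\<close>, on the tangent vectors with components \<open>v\<close>, \<open>w\<close> in that chart.
  The last condition is the transformation law of covariant 2-tensors.\<close>

type_synonym 'e local_metric = "'e \<Rightarrow> 'e \<Rightarrow> 'e \<Rightarrow> real"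

definition pseudo_riemannian ::
  "('a, 'e::euclidean_space, 'i) manifold \<Rightarrow> ('i \<Rightarrow> 'e local_metric) \<Rightarrow> bool" where
  "pseudo_riemannian M g \<longleftrightarrow>
     smooth_manifold M \<and>
     (\<forall>i\<in>indices M.
        (\<forall>v w. smooth_on (chart_image M i) (\<lambda>x. g i x v w)) \<and>
        (\<forall>x\<in>chart_image M i.
           bilinear (g i x) \<and>
           (\<forall>v w. g i x v w = g i x w v) \<and>
           (\<forall>v. (\<forall>w. g i x v w = 0) \<longrightarrow> v = 0))) \<and>
     (\<forall>i\<in>indices M. \<forall>j\<in>indices M. \<forall>x\<in>transition_dom M i j. \<forall>v w.
        g i x v w =
        g j (transition M i j x)
          (frechet_derivative (transition M i j) (at x) v)
          (frechet_derivative (transition M i j) (at x) w))"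

abbreviation dir_deriv ::
  "('e::real_normed_vector \<Rightarrow> 'b::real_normed_vector) \<Rightarrow> 'e \<Rightarrow> 'e \<Rightarrow> 'b" where
  "dir_deriv f x v \<equiv> frechet_derivative f (at x) v"

text \<open>\<open>christoffel G x v w\<close> is the vector with components \<open>\<Gamma>\<^sup>c\<^sub>a\<^sub>b v\<^sup>a w\<^sup>b\<close>, i.e. the Levi-Civita derivative at
  \<open>x\<close> of the constant vector field \<open>w\<close> in direction \<open>v\<close>; raising the index is expressed by \<open>THE\<close>.\<close>

definition christoffel :: "'e::euclidean_space local_metric \<Rightarrow> 'e \<Rightarrow> 'e \<Rightarrow> 'e \<Rightarrow> 'e" where
  "christoffel G x v w =
     (THE z. \<forall>y. G x z y =
        (dir_deriv (\<lambda>p. G p w y) x v + dir_deriv (\<lambda>p. G p v y) x w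
           - dir_deriv (\<lambda>p. G p v w) x y) / 2)"

text \<open>\<open>R(u,v)w = \<nabla>\<^sub>u\<nabla>\<^sub>v w - \<nabla>\<^sub>v\<nabla>\<^sub>u w\<close> for constant vector fields \<open>u\<close>, \<open>v\<close>, \<open>w\<close>.\<close>

definition curvature :: "'e::euclidean_space local_metric \<Rightarrow> 'e \<Rightarrow> 'e \<Rightarrow> 'e \<Rightarrow> 'e \<Rightarrow> 'e" where
  "curvature G x u v w =
     dir_deriv (\<lambda>p. christoffel G p v w) x u - dir_deriv (\<lambda>p. christoffel G p u w) x v
       + christoffel G x u (christoffel G x v w) - christoffel G x v (christoffel G x u w)"

text \<open>\<open>Ric(v,w)\<close> is the trace of \<open>z \<mapsto> R(z,v)w\<close>, which is positive for round spheres. The inner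
  product of \<open>'e\<close> only serves to pick out coordinates.\<close>

definition ricci :: "'e::euclidean_space local_metric \<Rightarrow> 'e \<Rightarrow> 'e \<Rightarrow> 'e \<Rightarrow> real" where
  "ricci G x v w = (\<Sum>b\<in>Basis. curvature G x b v w \<bullet> b)"

definition einstein ::
  "('a, 'e::euclidean_space, 'i) manifold \<Rightarrow> ('i \<Rightarrow> 'e local_metric) \<Rightarrow> real \<Rightarrow> bool" where
  "einstein M g c \<longleftrightarrow>
     pseudo_riemannian M g \<and>
     (\<forall>i\<in>indices M. \<forall>x\<in>chart_image M i. \<forall>v w. ricci (g i) x v w = c * g i x v w)"


section \<open>The metric on the product\<close>

text \<open>\<open>F\<close> has dimension \<open>DIM('e)\<close>, \<open>\<epsilon> = \<plusminus>1\<close> is the chosen sign, and \<open>a\<close>, \<open>b\<close>, \<open>v\<close> are the components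
  of a tangent vector in the directions of \<open>s\<close>, \<open>y\<close> and \<open>F\<close>.\<close>

definition total_space ::
  "('a, 'e::euclidean_space, 'i) manifold
     \<Rightarrow> (real \<times> real \<times> 'a, real \<times> real \<times> 'e, unit \<times> unit \<times> 'i) manifold" where
  "total_space F =
     prod_manifold (open_submanifold {0<..}) (prod_manifold (open_submanifold UNIV) F)"

definition total_metric ::
  "real \<Rightarrow> (real \<Rightarrow> real) \<Rightarrow> ('i \<Rightarrow> 'e::euclidean_space local_metric)
     \<Rightarrow> unit \<times> unit \<times> 'i \<Rightarrow> (real \<times> real \<times> 'e) local_metric" where
  "total_metric \<epsilon> u gF = (\<lambda>(_, _, i) (s, y, x) (a, b, v) (a', b', v').
     (let k = real DIM('e) in
      s powr (1 / k - 1) *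
        (1 / (4 * sqrt s * (u (sqrt s))\<^sup>2) * (a * a') + \<epsilon> * (4 * sqrt s * (u (sqrt s))\<^sup>2) * (b * b'))
      + s powr (2 / k) * gF i x v v'))"

end

theory Submission
  imports Defs
begin

text \<open>Put \<open>H(s) = 4\<surd>s u\<^sup>2(\<surd>s)\<close>. The metric is \<open>P ds\<^sup>2 + Q dy\<^sup>2 + W g\<^sub>F\<close> with \<open>P\<close>, \<open>Q\<close>, \<open>W\<close> depending only
  on \<open>s\<close>, and its Ricci tensor is \<open>\<alpha> (P ds\<^sup>2 + Q dy\<^sup>2) + Ric\<^sub>F - (s\<^sup>1\<^sup>/\<^sup>k H'/k) g\<^sub>F\<close> with
  \<open>\<alpha> P = -(H'' + H'/(ks))/(2H)\<close>. The fibre part of the Einstein equation is the linear first order equation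
  \<open>H' = k (\<nu> s\<^sup>-\<^sup>1\<^sup>/\<^sup>k - \<lambda> s\<^sup>1\<^sup>/\<^sup>k)\<close>; differentiating it gives the base part \<open>\<alpha> = \<lambda>\<close>. Integrating it and
  substituting \<open>s = r\<^sup>2\<close> gives the formula for \<open>u\<^sup>2(r)\<close>, with \<open>C\<close> the constant of integration.\<close>


section \<open>Calculus of smooth functions\<close>

text \<open>The obstacle is that \<open>christoffel\<close> is given by \<open>THE\<close> and then
  differentiated: before any curvature can be computed, it must be known to solve its defining
  linear system and to depend differentiably on the point. The exponents in the metric are tuned.
  With W = s^(2/k), the factor s^(1/k - 1) on the base is the only power of s for which the
  directions of s and y receive the same coefficient \<alpha> whatever H is, and W itself is such
  that the fibre coefficient has no term free of H'. Multiplied by s^(1/k), the fibre equation reads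
  s^(1/k) H' = k (\<nu> - lam s^(2/k)), and the base equation is the derivative of this; it knows
  s^(1/k) H' only up to a constant, which the fibre fixes as k \<nu>. Hence testing on fibre vectors
  already yields the differential equation. In the other direction \<open>einstein\<close> also
  demands that the total space be a manifold with a smooth metric, which is why products of
  manifolds are treated. The bound k \<ge> 2 keeps the exponent 1 - 1/k of the integrated equation
  away from 0.\<close>

lemma Ck_on_frechet_derivative: "Ck_on (Suc n) S f \<Longrightarrow> Ck_on n S (\<lambda>x. frechet_derivative f (at x) v)"
  by simp

lemma Ck_on_SucE:
  assumes "Ck_on (Suc n) S f" "x \<in> S"
  shows "(f has_derivative frechet_derivative f (at x)) (at x)"
  using assms by (simp add: frechet_derivative_works)

declare Ck_on.simps(2) [simp del]

lemma Ck_on_Suc_D: "Ck_on (Suc n) S f \<Longrightarrow> Ck_on n S f"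
proof (induction n arbitrary: f)
  case 0
  then show ?case
    by (auto simp: Ck_on.simps(2) intro!: continuous_at_imp_continuous_on differentiable_imp_continuous_within)
next
  case (Suc n)
  show ?case
    unfolding Ck_on.simps(2)
    using Suc.IH[OF Ck_on_frechet_derivative[OF Suc.prems]] Ck_on_SucE[OF Suc.prems]
    by (blast intro: differentiableI)
qed

text \<open>Openness of \<open>S\<close> makes derivatives at its points depend on values inside
  \<open>S\<close> only, so formulas valid just on \<open>S\<close> may be exchanged at every
  order.\<close>

lemma Ck_on_cong:
  assumes "open S" "\<And>x. x \<in> S \<Longrightarrow> f x = g x" "Ck_on n S f"
  shows "Ck_on n S g"
  using assms(2,3)
proof (induction n arbitrary: f g)
  case 0
  then show ?case using continuous_on_cong by (metis Ck_on.simps(1))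
next
  case (Suc n)
  have 1: "(g has_derivative frechet_derivative f (at x)) (at x)" if "x \<in> S" for x
    using Suc.prems(1) that assms(1) Ck_on_SucE[OF Suc.prems(2)]
    by (intro has_derivative_transform_within_open[of f _ x UNIV S g]) auto
  have "frechet_derivative f (at x) = frechet_derivative g (at x)" if "x \<in> S" for x
    using frechet_derivative_at[OF 1[OF that]] .
  then have "Ck_on n S (\<lambda>x. frechet_derivative g (at x) v)" for v
    by (intro Suc.IH[OF _ Ck_on_frechet_derivative[OF Suc.prems(2)]]) auto
  with 1 show ?case unfolding Ck_on.simps(2) by (blast intro: differentiableI)
qed

text \<open>Trades the chosen \<open>frechet_derivative\<close> for any explicit derivative, so that
  closure properties can be proved by the usual differentiation rules.\<close>

lemma Ck_on_SucI:
  assumes "open S" "\<And>x. x \<in> S \<Longrightarrow> (f has_derivative f' x) (at x)" "\<And>v. Ck_on n S (\<lambda>x. f' x v)"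
  shows "Ck_on (Suc n) S f"
proof -
  have "f' x = frechet_derivative f (at x)" if "x \<in> S" for x
    using assms(2)[OF that] by (rule frechet_derivative_at)
  then have "Ck_on n S (\<lambda>x. frechet_derivative f (at x) v)" for v
    by (intro Ck_on_cong[OF assms(1) _ assms(3)[of v]]) auto
  then show ?thesis unfolding Ck_on.simps(2) using assms(2) by (blast intro: differentiableI)
qed

lemma Ck_on_const: "open S \<Longrightarrow> Ck_on n S (\<lambda>x. c)"
  by (induction n arbitrary: c) (auto intro!: Ck_on_SucI[where f'="\<lambda>_ _. 0"])

lemma Ck_on_linear:
  fixes L :: "'a::euclidean_space \<Rightarrow> 'b::real_normed_vector"
  assumes "linear L" "open S"
  shows "Ck_on n S L"
proof (cases n)
  case 0
  then show ?thesis
    using assms by (simp add: linear_continuous_on linear_conv_bounded_linear)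
next
  case (Suc m)
  show ?thesis unfolding Suc
    using assms by (intro Ck_on_SucI[where f'="\<lambda>_. L"] Ck_on_const)
      (auto simp: linear_conv_bounded_linear bounded_linear_imp_has_derivative)
qed

lemma Ck_on_add:
  assumes "open S" "Ck_on n S f" "Ck_on n S g"
  shows "Ck_on n S (\<lambda>x. f x + g x)"
  using assms(2,3)
proof (induction n arbitrary: f g)
  case 0
  then show ?case by (auto intro: continuous_intros)
next
  case (Suc n)
  show ?case
    by (rule Ck_on_SucI[OF assms(1) has_derivative_add[OF Ck_on_SucE[OF Suc.prems(1)] Ck_on_SucE[OF Suc.prems(2)]]])
       (use Suc in \<open>auto intro: Ck_on_frechet_derivative\<close>)
qed

lemma Ck_on_mult:
  fixes f g :: "'a::euclidean_space \<Rightarrow> real"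
  assumes "open S" "Ck_on n S f" "Ck_on n S g"
  shows "Ck_on n S (\<lambda>x. f x * g x)"
  using assms(2,3)
proof (induction n arbitrary: f g)
  case 0
  then show ?case by (auto intro: continuous_intros)
next
  case (Suc n)
  show ?case
    by (rule Ck_on_SucI[OF assms(1) has_derivative_mult[OF Ck_on_SucE[OF Suc.prems(1)] Ck_on_SucE[OF Suc.prems(2)]]])
       (use Suc.prems in \<open>auto intro!: Ck_on_add[OF assms(1)] Suc.IH intro: Ck_on_Suc_D Ck_on_frechet_derivative\<close>)
qed

text \<open>The derivative of 1/f is -f' (1/f)^2, so in the induction step 1/f is needed only in the
  lower class, where the product rule applies.\<close>

lemma Ck_on_inverse:
  fixes f :: "'a::euclidean_space \<Rightarrow> real"
  assumes "open S" "\<And>x. x \<in> S \<Longrightarrow> f x \<noteq> 0" "Ck_on n S f"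
  shows "Ck_on n S (\<lambda>x. inverse (f x))"
  using assms(3)
proof (induction n)
  case 0
  then show ?case using assms(2) by (auto intro: continuous_intros)
next
  case (Suc n)
  have D: "((\<lambda>x. inverse (f x)) has_derivative
          (\<lambda>v. (-1) * (frechet_derivative f (at x) v * (inverse (f x) * inverse (f x))))) (at x)"
    if "x \<in> S" for x
    by (rule derivative_eq_intros Ck_on_SucE[OF Suc.prems that] assms(2) that)+ (simp add: fun_eq_iff)
  have "Ck_on n S (\<lambda>x. inverse (f x))"
    by (rule Suc.IH) (rule Ck_on_Suc_D[OF Suc.prems])
  then have "Ck_on n S (\<lambda>x. (-1) * (frechet_derivative f (at x) v * (inverse (f x) * inverse (f x))))" for v
    using Suc.prems by (intro Ck_on_mult[OF assms(1)] Ck_on_const[OF assms(1)] Ck_on_frechet_derivative)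
  from Ck_on_SucI[OF assms(1) D this] show ?case .
qed

lemma Ck_on_powr: "Ck_on n {0<..} (\<lambda>x::real. x powr c)"
proof (induction n arbitrary: c)
  case 0
  then show ?case by (auto intro!: continuous_intros)
next
  case (Suc n)
  have D: "((\<lambda>x::real. x powr c) has_derivative (\<lambda>v. v * c * x powr (c - 1))) (at x)"
    if "x \<in> {0<..}" for x
    by (rule has_derivative_eq_rhs[OF has_field_derivative_imp_has_derivative[OF has_real_derivative_powr[of x c]]])
       (use that in \<open>auto simp: fun_eq_iff\<close>)
  show ?case
    by (rule Ck_on_SucI[OF _ D]) (auto intro!: Ck_on_mult Ck_on_const Suc)
qed

lemma Ck_on_post:
  assumes "open S" "bounded_linear L" "Ck_on n S f"
  shows "Ck_on n S (\<lambda>x. L (f x))"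
  using assms(3)
proof (induction n arbitrary: f)
  case 0
  then show ?case using assms by (auto intro: bounded_linear.continuous_on)
next
  case (Suc n)
  show ?case
    by (rule Ck_on_SucI[OF assms(1) bounded_linear.has_derivative[OF assms(2) Ck_on_SucE[OF Suc.prems]]])
       (auto intro!: Suc.IH Ck_on_frechet_derivative Suc.prems)
qed

text \<open>For linear \<open>L\<close> the derivative of the composite along \<open>v\<close> is
  that of \<open>f\<close> along the fixed vector \<open>L v\<close>, so the induction hypothesis
  applies directly; for a general inner map this direction would vary with the point. The maps of
  interest are the projections of a product.\<close>

lemma Ck_on_pre:
  fixes L :: "'c::euclidean_space \<Rightarrow> 'a::euclidean_space"
  assumes "open T" "bounded_linear L" "L ` T \<subseteq> S" "Ck_on n S f"
  shows "Ck_on n T (\<lambda>x. f (L x))"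
  using assms(4)
proof (induction n arbitrary: f)
  case 0
  then show ?case using assms
    by (auto intro!: continuous_on_compose2[of S f] linear_continuous_on[of L])
next
  case (Suc n)
  have D: "((\<lambda>x. f (L x)) has_derivative (\<lambda>v. frechet_derivative f (at (L x)) (L v))) (at x)"
    if "x \<in> T" for x
    using that assms(3)
    by (intro has_derivative_compose[OF bounded_linear_imp_has_derivative[OF assms(2)] Ck_on_SucE[OF Suc.prems]]) auto
  show ?case
    by (rule Ck_on_SucI[OF assms(1) D]) (auto intro!: Suc.IH[OF Ck_on_frechet_derivative] Suc.prems)
qed


section \<open>Products of manifolds\<close>

lemma smooth_on_map_prod:
  fixes f :: "'a::euclidean_space \<Rightarrow> 'b::euclidean_space" and g :: "'c::euclidean_space \<Rightarrow> 'd::euclidean_space"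
  assumes "open A" "open B" "smooth_on A f" "smooth_on B g"
  shows "smooth_on (A \<times> B) (map_prod f g)"
proof -
  \<comment> \<open>The product map is a sum of two maps, each of them a factor placed between a
    linear projection and a linear inclusion.\<close>
  have "Ck_on n (A \<times> B) (\<lambda>z. (f (fst z), 0) + (0, g (snd z)))" for n
  proof (intro Ck_on_add open_Times assms)
    show "Ck_on n (A \<times> B) (\<lambda>z. (f (fst z), 0 :: 'd))"
      by (rule Ck_on_post[where L = "\<lambda>u. (u, 0)"], rule open_Times[OF assms(1,2)],
          intro bounded_linear_Pair bounded_linear_ident bounded_linear_zero,
          rule Ck_on_pre[where S = A])
         (use assms bounded_linear_fst in \<open>auto simp: smooth_on_def open_Times\<close>)
    show "Ck_on n (A \<times> B) (\<lambda>z. (0 :: 'b, g (snd z)))"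
      by (rule Ck_on_post[where L = "\<lambda>u. (0, u)"], rule open_Times[OF assms(1,2)],
          intro bounded_linear_Pair bounded_linear_ident bounded_linear_zero,
          rule Ck_on_pre[where S = B])
         (use assms bounded_linear_snd in \<open>auto simp: smooth_on_def open_Times\<close>)
  qed
  then show ?thesis by (simp add: smooth_on_def map_prod_def case_prod_unfold)
qed

lemma has_derivative_map_prod:
  assumes "(f has_derivative f') (at x)" "(g has_derivative g') (at y)"
  shows "(map_prod f g has_derivative map_prod f' g') (at (x, y))"
proof -
  have "((\<lambda>z. f (fst z)) has_derivative (\<lambda>d. f' (fst d))) (at (x, y))"
    using has_derivative_compose[of fst fst "(x, y)" UNIV f f'] assms(1)
      has_derivative_fst[OF has_derivative_ident, of "at (x, y)"] by simp
  moreover have "((\<lambda>z. g (snd z)) has_derivative (\<lambda>d. g' (snd d))) (at (x, y))"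
    using has_derivative_compose[of snd snd "(x, y)" UNIV g g'] assms(2)
      has_derivative_snd[OF has_derivative_ident, of "at (x, y)"] by simp
  ultimately show ?thesis
    using has_derivative_Pair by (fastforce simp: map_prod_def case_prod_unfold)
qed

lemma second_countable_euclidean: "second_countable (euclidean :: 'a::second_countable_topology topology)"
proof -
  obtain B :: "'a set set" where B: "countable B" "topological_basis B"
    using ex_countable_basis by blast
  then show ?thesis
    unfolding second_countable_def by (meson open_openin topological_basis_def topological_basisE)
qed

lemma second_countable_prod_topology:
  assumes "second_countable X" "second_countable Y"
  shows "second_countable (prod_topology X Y)"
proof -
  obtain B where B: "countable B" "\<And>V. V \<in> B \<Longrightarrow> openin X V"
    "\<And>U x. openin X U \<Longrightarrow> x \<in> U \<Longrightarrow> \<exists>V\<in>B. x \<in> V \<and> V \<subseteq> U"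
    using assms(1) unfolding second_countable_def by metis
  obtain C where C: "countable C" "\<And>V. V \<in> C \<Longrightarrow> openin Y V"
    "\<And>U x. openin Y U \<Longrightarrow> x \<in> U \<Longrightarrow> \<exists>V\<in>C. x \<in> V \<and> V \<subseteq> U"
    using assms(2) unfolding second_countable_def by metis
  show ?thesis
    unfolding second_countable_def
  proof (intro exI[of _ "(\<lambda>(U, V). U \<times> V) ` (B \<times> C)"] conjI ballI allI impI)
    show "countable ((\<lambda>(U, V). U \<times> V) ` (B \<times> C))" using B(1) C(1) by auto
    show "openin (prod_topology X Y) V" if "V \<in> (\<lambda>(U, V). U \<times> V) ` (B \<times> C)" for V
      using that B(2) C(2) by (auto simp: openin_prod_Times_iff)
    fix U z assume "openin (prod_topology X Y) U \<and> z \<in> U"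
    then obtain A A' where A: "openin X A" "openin Y A'" "fst z \<in> A" "snd z \<in> A'" "A \<times> A' \<subseteq> U"
      unfolding openin_prod_topology_alt by (metis prod.collapse)
    obtain V V' where "V \<in> B" "fst z \<in> V" "V \<subseteq> A" "V' \<in> C" "snd z \<in> V'" "V' \<subseteq> A'"
      using B(3)[OF A(1,3)] C(3)[OF A(2,4)] by blast
    then show "\<exists>V\<in>(\<lambda>(U, V). U \<times> V) ` (B \<times> C). z \<in> V \<and> V \<subseteq> U"
      using A(5) by (intro bexI[of _ "V \<times> V'"]) (auto simp: mem_Times_iff)
  qed
qed

lemma homeomorphic_map_map_prod:
  assumes "homeomorphic_map X X' f" "homeomorphic_map Y Y' g"
  shows "homeomorphic_map (prod_topology X Y) (prod_topology X' Y') (map_prod f g)"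
proof -
  obtain f' g' where "homeomorphic_maps X X' f f'" "homeomorphic_maps Y Y' g g'"
    using assms unfolding homeomorphic_map_maps by blast
  then have "homeomorphic_maps (prod_topology X Y) (prod_topology X' Y')
      (\<lambda>(x, y). (f x, g y)) (\<lambda>(x, y). (f' x, g' y))"
    by (simp add: homeomorphic_maps_prod)
  then show ?thesis unfolding homeomorphic_map_maps map_prod_def by blast
qed

section \<open>Charts and transition maps of a product\<close>

lemma chart_inj_on:
  assumes "smooth_manifold M" "i \<in> indices M"
  shows "inj_on (chart M i) (chart_dom M i)"
proof -
  have "homeomorphic_map (subtopology (mtopology M) (chart_dom M i)) (top_of_set (chart_image M i)) (chart M i)"
    "chart_dom M i \<subseteq> topspace (mtopology M)"
    using assms unfolding smooth_manifold_def by (blast dest: openin_subset)+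
  then show ?thesis
    using homeomorphic_imp_injective_map by (metis topspace_subtopology_subset)
qed

text \<open>The chart is a homeomorphism onto an open set of \<open>'e\<close>, so the overlap, open
  in the chart domain, has open image. Derivatives of transition maps are thus taken at interior
  points.\<close>

lemma open_transition_dom:
  assumes "smooth_manifold M" "i \<in> indices M" "j \<in> indices M"
  shows "open (transition_dom M i j)"
proof -
  have h: "homeomorphic_map (subtopology (mtopology M) (chart_dom M i)) (top_of_set (chart_image M i)) (chart M i)"
    and o: "openin (mtopology M) (chart_dom M i)" "openin (mtopology M) (chart_dom M j)" "open (chart_image M i)"
    using assms unfolding smooth_manifold_def by blast+
  have "openin (subtopology (mtopology M) (chart_dom M i)) (chart_dom M i \<inter> chart_dom M j)"
    using o by (simp add: openin_open_subtopology openin_Int)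
  then have "openin (top_of_set (chart_image M i)) (transition_dom M i j)"
    using homeomorphic_imp_open_map[OF h] unfolding open_map_def transition_dom_def by blast
  then show ?thesis using o(3) openin_open_trans by blast
qed

lemma chart_image_prod [simp]: "chart_image (prod_manifold M N) (i, i') = chart_image M i \<times> chart_image N i'"
  by (auto simp: chart_image_def prod_manifold_def)

lemma transition_dom_prod [simp]:
  "transition_dom (prod_manifold M N) (i, i') (j, j') = transition_dom M i j \<times> transition_dom N i' j'"
  by (auto simp: transition_dom_def prod_manifold_def)

text \<open>Stated on the transition domain because \<open>the_inv_into\<close> has no prescribed
  value off the chart image.\<close>

lemma transition_prod:
  assumes M: "smooth_manifold M" "i \<in> indices M" and N: "smooth_manifold N" "i' \<in> indices N"
    and z: "z \<in> transition_dom (prod_manifold M N) (i, i') (j, j')"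
  shows "transition (prod_manifold M N) (i, i') (j, j') z =
    map_prod (transition M i j) (transition N i' j') z"
proof -
  from z obtain u v where uv: "z = (chart M i u, chart N i' v)" "u \<in> chart_dom M i" "v \<in> chart_dom N i'"
    by (auto simp: transition_dom_def prod_manifold_def)
  have inj: "inj_on (chart M i) (chart_dom M i)" "inj_on (chart N i') (chart_dom N i')"
    by (rule chart_inj_on[OF M] chart_inj_on[OF N])+
  then have "inj_on (map_prod (chart M i) (chart N i')) (chart_dom M i \<times> chart_dom N i')"
    by (rule map_prod_inj_on)
  from the_inv_into_f_f[OF this, of "(u, v)"] show ?thesis
    using uv by (simp add: transition_def prod_manifold_def the_inv_into_f_f inj)
qed

lemma smooth_manifold_prod:
  assumes M: "smooth_manifold M" and N: "smooth_manifold N"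
  shows "smooth_manifold (prod_manifold M N)"
  unfolding smooth_manifold_def
proof (intro conjI ballI)
  have ne: "topspace (mtopology M) \<noteq> {}" "topspace (mtopology N) \<noteq> {}"
    and hd: "Hausdorff_space (mtopology M)" "Hausdorff_space (mtopology N)"
    and sc: "second_countable (mtopology M)" "second_countable (mtopology N)"
    and un: "(\<Union>i\<in>indices M. chart_dom M i) = topspace (mtopology M)"
      "(\<Union>i\<in>indices N. chart_dom N i) = topspace (mtopology N)"
    using M N unfolding smooth_manifold_def by blast+
  show "topspace (mtopology (prod_manifold M N)) \<noteq> {}" using ne by (simp add: prod_manifold_def)
  show "Hausdorff_space (mtopology (prod_manifold M N))"
    using hd by (simp add: prod_manifold_def Hausdorff_space_prod_topology)
  show "second_countable (mtopology (prod_manifold M N))"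
    using sc by (simp add: prod_manifold_def second_countable_prod_topology)
  show "(\<Union>i\<in>indices (prod_manifold M N). chart_dom (prod_manifold M N) i) = topspace (mtopology (prod_manifold M N))"
    by (simp add: prod_manifold_def un[symmetric]) fast
next
  fix l assume "l \<in> indices (prod_manifold M N)"
  then obtain i i' where l: "l = (i, i')" "i \<in> indices M" "i' \<in> indices N"
    by (auto simp: prod_manifold_def)
  have o: "openin (mtopology M) (chart_dom M i)" "openin (mtopology N) (chart_dom N i')"
    and im: "open (chart_image M i)" "open (chart_image N i')"
    and h: "homeomorphic_map (subtopology (mtopology M) (chart_dom M i)) (top_of_set (chart_image M i)) (chart M i)"
      "homeomorphic_map (subtopology (mtopology N) (chart_dom N i')) (top_of_set (chart_image N i')) (chart N i')"
    using M N l unfolding smooth_manifold_def by blast+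
  show "openin (mtopology (prod_manifold M N)) (chart_dom (prod_manifold M N) l)"
    using o by (simp add: l prod_manifold_def openin_prod_Times_iff)
  show "open (chart_image (prod_manifold M N) l)"
    using im by (simp add: l open_Times)
  show "homeomorphic_map (subtopology (mtopology (prod_manifold M N)) (chart_dom (prod_manifold M N) l))
          (top_of_set (chart_image (prod_manifold M N) l)) (chart (prod_manifold M N) l)"
    using homeomorphic_map_map_prod[OF h] unfolding l chart_image_prod
    by (simp add: prod_manifold_def subtopology_Times)
  fix l' assume "l' \<in> indices (prod_manifold M N)"
  then obtain j j' where l': "l' = (j, j')" "j \<in> indices M" "j' \<in> indices N"
    by (auto simp: prod_manifold_def)
  note ot = open_transition_dom[OF M l(2) l'(2)] open_transition_dom[OF N l(3) l'(3)]
  have "smooth_on (transition_dom M i j \<times> transition_dom N i' j') (map_prod (transition M i j) (transition N i' j'))"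
    using ot
  proof (rule smooth_on_map_prod)
    show "smooth_on (transition_dom M i j) (transition M i j)"
      using M l(2) l'(2) unfolding smooth_manifold_def by blast
    show "smooth_on (transition_dom N i' j') (transition N i' j')"
      using N l(3) l'(3) unfolding smooth_manifold_def by blast
  qed
  then have "Ck_on n (transition_dom M i j \<times> transition_dom N i' j')
      (map_prod (transition M i j) (transition N i' j'))" for n
    by (simp add: smooth_on_def)
  then show "smooth_on (transition_dom (prod_manifold M N) l l') (transition (prod_manifold M N) l l')"
    unfolding smooth_on_def l l' transition_dom_prod
    by (intro allI Ck_on_cong[OF open_Times[OF ot] transition_prod[OF M l(2) N l(3), symmetric]])
       (simp_all only: transition_dom_prod)
qed

section \<open>Open subsets of Euclidean space as manifolds with one chart\<close>

lemma chart_image_open_submanifold [simp]: "chart_image (open_submanifold S) i = S"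
  by (simp add: chart_image_def open_submanifold_def)

lemma transition_dom_open_submanifold [simp]: "transition_dom (open_submanifold S) i j = S"
  by (simp add: transition_dom_def open_submanifold_def)

lemma transition_open_submanifold: "x \<in> S \<Longrightarrow> transition (open_submanifold S) i j x = x"
  using the_inv_into_f_f[of "\<lambda>x. x" S x] by (simp add: transition_def open_submanifold_def inj_on_def)

lemma smooth_manifold_open_submanifold:
  assumes "open S" "S \<noteq> {}"
  shows "smooth_manifold (open_submanifold S)"
proof -
  have "smooth_on S (transition (open_submanifold S) i j)" for i j
    unfolding smooth_on_def
    by (intro allI Ck_on_cong[OF assms(1) _ Ck_on_linear[OF linear_ident assms(1)]])
       (simp add: transition_open_submanifold)
  moreover have "homeomorphic_map (top_of_set S) (top_of_set S) (\<lambda>x. x)"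
    using homeomorphic_map_id[of "top_of_set S" "top_of_set S"] by (simp add: id_def)
  ultimately show ?thesis
    using assms
    unfolding smooth_manifold_def chart_image_open_submanifold transition_dom_open_submanifold
    by (auto simp: open_submanifold_def subtopology_subtopology Hausdorff_space_subtopology second_countable_subtopology
        second_countable_euclidean)
qed

lemma transition_differentiable:
  assumes "smooth_manifold M" "i \<in> indices M" "j \<in> indices M" "x \<in> transition_dom M i j"
  shows "transition M i j differentiable (at x)"
proof -
  have "Ck_on (Suc 0) (transition_dom M i j) (transition M i j)"
    using assms unfolding smooth_manifold_def smooth_on_def by blast
  then show ?thesis using assms(4) by (simp only: Ck_on.simps(2))
qed


section \<open>Solving linear systems depending on parameters\<close>

text \<open>Nondegeneracy makes the map from vectors to functionals injective, and equality of
  dimensions makes it surjective. This raises an index for a form of any signature.\<close>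

lemma bilinear_form_represents:
  fixes B :: "'e::euclidean_space \<Rightarrow> 'e \<Rightarrow> real"
  assumes B: "bilinear B" and nondeg: "\<And>v. (\<And>w. B v w = 0) \<Longrightarrow> v = 0" and f: "linear f"
  shows "\<exists>z. \<forall>y. B z y = f y"
proof -
  interpret l: linear "\<lambda>x. B x y" for y using B by (simp add: bilinear_def)
  have r: "linear (B x)" for x using B by (simp add: bilinear_def)
  define L where "L z = (\<Sum>b\<in>Basis. B z b *\<^sub>R b)" for z
  have lin: "linear L"
    by (rule linearI) (simp_all add: L_def l.add l.scale scaleR_add_left sum.distrib scaleR_sum_right)
  have L_inner: "L z \<bullet> b = B z b" if "b \<in> Basis" for z b
    using that by (simp add: L_def inner_sum_left_Basis)
  have "inj L"
  proof (subst linear_injective_0[OF lin], intro allI impI)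
    fix z assume "L z = 0"
    then have "B z b = 0" if "b \<in> Basis" for b
      using L_inner[OF that, of z] by simp
    then have "B z y = 0" for y
      using linear_eq_stdbasis[OF r linear_zero, of z] by metis
    then show "z = 0" by (rule nondeg)
  qed
  then have "surj L" by (rule linear_injective_imp_surjective[OF lin]) (rule refl)
  then obtain z where "L z = (\<Sum>b\<in>Basis. f b *\<^sub>R b)" by (metis surjD)
  then have "B z b = f b" if "b \<in> Basis" for b
    using L_inner[OF that, of z] that by (simp add: inner_sum_left_Basis)
  then have "B z = f" by (rule linear_eq_stdbasis[OF r f])
  then show ?thesis by auto
qed

lemma differentiable_scaleR_const:
  "f differentiable F \<Longrightarrow> (\<lambda>x. f x *\<^sub>R c) differentiable F"
  unfolding differentiable_def by (blast intro: has_derivative_scaleR_left)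

text \<open>Continuity of \<open>h\<close> suffices here because \<open>\<delta>\<close> vanishes at \<open>x\<close>.\<close>

lemma has_derivative_mult_vanishing:
  fixes h \<delta> :: "'a::real_normed_vector \<Rightarrow> real"
  assumes h: "isCont h x" and \<delta>: "(\<delta> has_derivative D) (at x)" and "\<delta> x = 0"
  shows "((\<lambda>p. h p * \<delta> p) has_derivative (\<lambda>v. h x * D v)) (at x)"
proof -
  have D: "bounded_linear D" using \<delta> by (rule has_derivative_bounded_linear)
  obtain d0 where "d0 > 0" and d0: "\<And>y. norm (y - x) < d0 \<Longrightarrow> norm (\<delta> y - D (y - x)) \<le> 1 * norm (y - x)"
    using \<delta> \<open>\<delta> x = 0\<close> unfolding has_derivative_at_alt by (metis diff_zero zero_less_one)
  obtain K where K: "K > 0" "\<And>v. norm (D v) \<le> norm v * K"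
    using bounded_linear.pos_bounded[OF D] by blast
  have bd: "\<bar>\<delta> y\<bar> \<le> (1 + K) * norm (y - x)" if "norm (y - x) < d0" for y
    using d0[OF that] K(2)[of "y - x"] by (simp add: algebra_simps)
  have "((\<lambda>p. (h p - h x) * \<delta> p) has_derivative (\<lambda>v. 0)) (at x)"
    unfolding has_derivative_at_alt
  proof (intro conjI allI impI)
    fix e :: real assume "e > 0"
    then have "e / (1 + K) > 0" using K by simp
    then obtain d1 where "d1 > 0" and d1: "\<And>y. norm (y - x) < d1 \<Longrightarrow> norm (h y - h x) < e / (1 + K)"
      using h unfolding continuous_at_eps_delta dist_norm by blast
    show "\<exists>d>0. \<forall>y. norm (y - x) < d \<longrightarrow>
        norm ((h y - h x) * \<delta> y - (h x - h x) * \<delta> x - 0) \<le> e * norm (y - x)"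
    proof (intro exI[of _ "min d0 d1"] conjI allI impI)
      fix y assume y: "norm (y - x) < min d0 d1"
      have "\<bar>h y - h x\<bar> * \<bar>\<delta> y\<bar> \<le> e / (1 + K) * ((1 + K) * norm (y - x))"
        using bd[of y] d1[of y] y \<open>e / (1 + K) > 0\<close> by (intro mult_mono) auto
      also have "\<dots> = e * norm (y - x)" using K by simp
      finally show "norm ((h y - h x) * \<delta> y - (h x - h x) * \<delta> x - 0) \<le> e * norm (y - x)"
        by (simp add: abs_mult)
    qed (use \<open>d0 > 0\<close> \<open>d1 > 0\<close> in auto)
  qed simp
  from has_derivative_add[OF has_derivative_mult_right[OF \<delta>, of "h x"] this] show ?thesis
    by (simp add: algebra_simps)
qed

text \<open>With \<open>M\<close> inverting \<open>B x\<close>, the solution satisfies \<open>z p = M (f p) - M ((B p - B x) (z p))\<close>. As \<open>B p - B x\<close>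
  tends to \<open>0\<close>, this first bounds \<open>z\<close> near \<open>x\<close>, then shows that it is continuous at \<open>x\<close>, and then differentiable.\<close>

lemma differentiable_linear_solve:
  fixes B :: "'p::real_normed_vector \<Rightarrow> 'e::euclidean_space \<Rightarrow> 'e \<Rightarrow> real"
  assumes "open S" "x \<in> S"
    and B: "\<And>p. p \<in> S \<Longrightarrow> bilinear (B p)" and nondeg: "\<And>v. (\<And>w. B x v w = 0) \<Longrightarrow> v = 0"
    and Bdiff: "\<And>v w. (\<lambda>p. B p v w) differentiable (at x)"
    and fdiff: "\<And>y. (\<lambda>p. f p y) differentiable (at x)"
    and eq: "\<And>p y. p \<in> S \<Longrightarrow> B p (z p) y = f p y"
  shows "z differentiable (at x)"
proof -
  define L where "L p v = (\<Sum>b\<in>Basis. B p v b *\<^sub>R b)" for p v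
  have linB: "linear (\<lambda>v. B p v w)" "linear (B p v)" if "p \<in> S" for p v w
    using B[OF that] by (simp_all add: bilinear_def)
  have lin: "linear (L x)"
    by (rule linearI) (simp_all add: L_def linear_add[OF linB(1)] linear_scale[OF linB(1)] \<open>x \<in> S\<close>
        scaleR_add_left sum.distrib scaleR_sum_right)
  have "inj (L x)"
  proof (subst linear_injective_0[OF lin], intro allI impI)
    fix v assume "L x v = 0"
    then have "B x v b = 0" if "b \<in> Basis" for b
      using that by (metis L_def inner_sum_left_Basis inner_zero_left)
    then have "B x v y = 0" for y
      using linear_eq_stdbasis[OF linB(2)[OF \<open>x \<in> S\<close>] linear_zero, of v] by metis
    then show "v = 0" by (rule nondeg)
  qed
  then obtain M where "linear M" and M_L: "\<And>v. M (L x v) = v"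
    using linear_injective_left_inverse[OF lin] by (metis comp_apply id_apply)
  define \<sigma> where "\<sigma> p = (\<Sum>b\<in>Basis. f p b *\<^sub>R M b)" for p
  define \<delta> where "\<delta> c b p = B p c b - B x c b" for c b p
  have z_eq: "z p = \<sigma> p - (\<Sum>b\<in>Basis. \<Sum>c\<in>Basis. ((z p \<bullet> c) * \<delta> c b p) *\<^sub>R M b)" if p: "p \<in> S" for p
  proof -
    have *: "B q v b = (\<Sum>c\<in>Basis. (v \<bullet> c) * B q c b)" if "q \<in> S" for q v b
      using linear_sum[OF linB(1)[OF that, of b], of "\<lambda>c. (v \<bullet> c) *\<^sub>R c" Basis]
      by (simp add: euclidean_representation linear_scale[OF linB(1)[OF that]])
    have "z p = M (L x (z p))" by (simp add: M_L)
    also have "\<dots> = (\<Sum>b\<in>Basis. B x (z p) b *\<^sub>R M b)"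
      by (simp add: L_def linear_sum[OF \<open>linear M\<close>] linear_scale[OF \<open>linear M\<close>])
    also have "\<dots> = (\<Sum>b\<in>Basis. f p b *\<^sub>R M b - (\<Sum>c\<in>Basis. ((z p \<bullet> c) * \<delta> c b p) *\<^sub>R M b))"
    proof (rule sum.cong)
      fix b :: 'e
      have "B x (z p) b = f p b - (\<Sum>c\<in>Basis. (z p \<bullet> c) * \<delta> c b p)"
        unfolding eq[OF p, symmetric] *[OF \<open>x \<in> S\<close>, of "z p"] *[OF p, of "z p"]
        by (simp add: \<delta>_def right_diff_distrib sum_subtractf)
      then show "B x (z p) b *\<^sub>R M b = f p b *\<^sub>R M b - (\<Sum>c\<in>Basis. ((z p \<bullet> c) * \<delta> c b p) *\<^sub>R M b)"
        by (simp add: scaleR_diff_left scaleR_sum_left)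
    qed simp
    finally show ?thesis by (simp add: \<sigma>_def sum_subtractf)
  qed
  have \<delta>_diff: "\<delta> c b differentiable (at x)" for c b
    unfolding \<delta>_def by (intro differentiable_diff Bdiff differentiable_const)
  have \<sigma>_diff: "\<sigma> differentiable (at x)"
    unfolding \<sigma>_def by (auto intro!: differentiable_sum intro: differentiable_scaleR_const fdiff)
  have \<delta>_lim: "(\<delta> c b \<longlongrightarrow> 0) (at x)" for c b
    using differentiable_imp_continuous_within[OF \<delta>_diff[of c b]] by (simp add: continuous_at \<delta>_def)
  have \<sigma>_lim: "(\<sigma> \<longlongrightarrow> \<sigma> x) (at x)"
    using differentiable_imp_continuous_within[OF \<sigma>_diff] by (simp add: continuous_at)
  have evS: "\<forall>\<^sub>F p in at x. p \<in> S"
    using assms(1,2) by (rule eventually_at_in_open')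
  have z_bounded: "\<exists>K. \<forall>\<^sub>F p in at x. norm (z p) \<le> K"
  proof -
    let ?n = "\<lambda>p. \<Sum>b\<in>Basis. \<Sum>c\<in>Basis. \<bar>\<delta> c b p\<bar> * norm (M b)"
    have "(?n \<longlongrightarrow> (\<Sum>b\<in>(Basis::'e set). \<Sum>c\<in>(Basis::'e set). \<bar>0\<bar> * norm (M b))) (at x)"
      by (intro tendsto_sum tendsto_mult tendsto_rabs \<delta>_lim tendsto_const)
    \<comment> \<open>The bound 1/2 lets the correction term be absorbed: norm (z p) is at most norm
      (\<sigma> p) + norm (z p) / 2.\<close>
    then have "\<forall>\<^sub>F p in at x. ?n p < 1/2"
      by (intro order_tendstoD(2)) auto
    moreover have "\<forall>\<^sub>F p in at x. norm (\<sigma> p) < norm (\<sigma> x) + 1"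
      by (intro order_tendstoD(2)[OF tendsto_norm[OF \<sigma>_lim]]) auto
    ultimately have "\<forall>\<^sub>F p in at x. norm (z p) \<le> 2 * (norm (\<sigma> x) + 1)"
      using evS
    proof eventually_elim
      case (elim p)
      have "norm (z p) \<le> norm (\<sigma> p) + norm (\<Sum>b\<in>Basis. \<Sum>c\<in>Basis. ((z p \<bullet> c) * \<delta> c b p) *\<^sub>R M b)"
        by (subst z_eq[OF elim(3)]) (rule norm_triangle_ineq4)
      also have "norm (\<Sum>b\<in>Basis. \<Sum>c\<in>Basis. ((z p \<bullet> c) * \<delta> c b p) *\<^sub>R M b) \<le>
          (\<Sum>b\<in>Basis. \<Sum>c\<in>Basis. norm (z p) * (\<bar>\<delta> c b p\<bar> * norm (M b)))"
        by (intro sum_norm_le) (auto simp: abs_mult mult.assoc intro!: mult_right_mono Basis_le_norm)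
      also have "\<dots> = norm (z p) * ?n p" by (simp add: sum_distrib_left)
      also have "\<dots> \<le> norm (z p) * (1/2)" using elim(1) by (intro mult_left_mono) auto
      finally show ?case using elim(2) by simp
    qed
    then show ?thesis by blast
  qed
  then obtain K where K: "\<forall>\<^sub>F p in at x. norm (z p) \<le> K" by blast
  have "((\<lambda>p. (z p \<bullet> c) * \<delta> c b p) \<longlongrightarrow> 0) (at x)" if "c \<in> Basis" for c b
  proof (rule Lim_null_comparison)
    show "((\<lambda>p. K * \<bar>\<delta> c b p\<bar>) \<longlongrightarrow> 0) (at x)"
      using tendsto_mult_right_zero[OF tendsto_rabs_zero[OF \<delta>_lim]] by blast
    show "\<forall>\<^sub>F p in at x. norm ((z p \<bullet> c) * \<delta> c b p) \<le> K * \<bar>\<delta> c b p\<bar>"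
      using K
    proof eventually_elim
      case (elim p)
      have "\<bar>z p \<bullet> c\<bar> \<le> K" using Basis_le_norm[OF that, of "z p"] elim by simp
      then show ?case by (simp add: abs_mult mult_right_mono)
    qed
  qed
  then have "((\<lambda>p. \<sigma> p - (\<Sum>b\<in>Basis. \<Sum>c\<in>Basis. ((z p \<bullet> c) * \<delta> c b p) *\<^sub>R M b)) \<longlongrightarrow>
      \<sigma> x - (\<Sum>b\<in>(Basis::'e set). \<Sum>c\<in>(Basis::'e set). 0 *\<^sub>R M b)) (at x)"
    by (intro tendsto_diff \<sigma>_lim tendsto_sum tendsto_scaleR tendsto_const) auto
  moreover have "z x = \<sigma> x"
    by (subst z_eq[OF \<open>x \<in> S\<close>]) (simp add: \<delta>_def)
  ultimately have "((\<lambda>p. \<sigma> p - (\<Sum>b\<in>Basis. \<Sum>c\<in>Basis. ((z p \<bullet> c) * \<delta> c b p) *\<^sub>R M b)) \<longlongrightarrow> z x) (at x)"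
    by simp
  then have "(z \<longlongrightarrow> z x) (at x)"
    by (rule Lim_transform_eventually) (rule eventually_mono[OF evS z_eq[symmetric]])
  then have "isCont (\<lambda>p. z p \<bullet> c) x" for c
    by (auto simp: continuous_at intro!: tendsto_inner)
  then have "(\<lambda>p. (z p \<bullet> c) * \<delta> c b p) differentiable (at x)" for b c
  proof -
    obtain D where "(\<delta> c b has_derivative D) (at x)"
      using \<delta>_diff[of c b] unfolding differentiable_def by blast
    with \<open>isCont (\<lambda>p. z p \<bullet> c) x\<close> show ?thesis
      by (rule has_derivative_mult_vanishing[THEN differentiableI]) (simp add: \<delta>_def)
  qed
  then have "(\<lambda>p. \<sigma> p - (\<Sum>b\<in>Basis. \<Sum>c\<in>Basis. ((z p \<bullet> c) * \<delta> c b p) *\<^sub>R M b)) differentiable (at x)"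
    by (auto intro!: differentiable_diff \<sigma>_diff differentiable_sum intro: differentiable_scaleR_const)
  then obtain D where
    "((\<lambda>p. \<sigma> p - (\<Sum>b\<in>Basis. \<Sum>c\<in>Basis. ((z p \<bullet> c) * \<delta> c b p) *\<^sub>R M b)) has_derivative D) (at x)"
    unfolding differentiable_def by blast
  then have "(z has_derivative D) (at x)"
    by (rule has_derivative_transform_within_open[OF _ assms(1,2)]) (rule z_eq[symmetric])
  then show ?thesis by (rule differentiableI)
qed


section \<open>Christoffel symbols in a chart\<close>

text \<open>The Christoffel symbol with lowered index: the right-hand side of the Koszul formula for
  constant vector fields, whose brackets vanish.\<close>

definition koszul :: "'e::euclidean_space local_metric \<Rightarrow> 'e \<Rightarrow> 'e \<Rightarrow> 'e \<Rightarrow> 'e \<Rightarrow> real" where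
  "koszul G x v w y =
     (dir_deriv (\<lambda>p. G p w y) x v + dir_deriv (\<lambda>p. G p v y) x w - dir_deriv (\<lambda>p. G p v w) x y) / 2"

text \<open>Asks only for bilinearity and nondegeneracy at the one point \<open>x\<close>, so it
  also serves for a warped metric not yet known to be smooth.\<close>

lemma christoffel_eqI:
  assumes "bilinear (G x)" and "\<And>v. (\<And>w. G x v w = 0) \<Longrightarrow> v = 0"
    and "\<And>y. G x z y = koszul G x v w y"
  shows "christoffel G x v w = z"
  unfolding christoffel_def koszul_def[symmetric]
proof (rule the_equality)
  fix z' assume "\<forall>y. G x z' y = koszul G x v w y"
  then have "G x (z' - z) y = 0" for y
    using assms(3)[of y] bilinear_lsub[OF assms(1), of z' z y] by simp
  then show "z' = z" using assms(2)[of "z' - z"] by simp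
qed (use assms(3) in simp)

text \<open>One chart of a pseudo-Riemannian manifold. Curvature is computed chart by chart; the
  transformation law enters only when the total space is shown to carry a metric.\<close>

locale local_metric =
  fixes S :: "'e::euclidean_space set" and G :: "'e local_metric"
  assumes S_open: "open S"
    and smooth: "smooth_on S (\<lambda>x. G x v w)"
    and bil: "x \<in> S \<Longrightarrow> bilinear (G x)"
    and sym: "x \<in> S \<Longrightarrow> G x v w = G x w v"
    and nondeg: "x \<in> S \<Longrightarrow> (\<And>w. G x v w = 0) \<Longrightarrow> v = 0"
begin

abbreviation dG :: "'e \<Rightarrow> 'e \<Rightarrow> 'e \<Rightarrow> 'e \<Rightarrow> real" where
  "dG x v w \<equiv> frechet_derivative (\<lambda>p. G p v w) (at x)"

lemma G_has_derivative:
  assumes "x \<in> S"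
  shows "((\<lambda>p. G p v w) has_derivative dG x v w) (at x)"
proof -
  have "Ck_on (Suc 0) S (\<lambda>x. G x v w)" using smooth unfolding smooth_on_def by blast
  then show ?thesis using assms by (simp add: Ck_on.simps(2) frechet_derivative_works)
qed

lemma dG_differentiable:
  assumes "x \<in> S"
  shows "(\<lambda>p. dG p v w d) differentiable (at x)"
proof -
  have "Ck_on (Suc (Suc 0)) S (\<lambda>x. G x v w)" using smooth unfolding smooth_on_def by blast
  then show ?thesis using assms by (simp add: Ck_on.simps(2))
qed

lemma dG_eqI:
  assumes "x \<in> S" "(f has_derivative f') (at x)" "\<And>p. p \<in> S \<Longrightarrow> f p = G p v w"
  shows "dG x v w = f'"
  using has_derivative_transform_within_open[OF assms(2) S_open assms(1), of "\<lambda>p. G p v w"] assms(3)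
  by (metis frechet_derivative_at)

lemma dG_linear:
  assumes "x \<in> S"
  shows "dG x v w (d + d') = dG x v w d + dG x v w d'" "dG x v w (c *\<^sub>R d) = c * dG x v w d"
  using linear_add[OF has_derivative_linear[OF G_has_derivative[OF assms]]]
    linear_scale[OF has_derivative_linear[OF G_has_derivative[OF assms]]] by auto

lemma dG_sym: "x \<in> S \<Longrightarrow> dG x v w = dG x w v"
  by (rule dG_eqI[OF _ G_has_derivative]) (auto simp: sym)

lemma dG_add_left:
  assumes "x \<in> S"
  shows "dG x (v + v') w d = dG x v w d + dG x v' w d"
  by (subst dG_eqI[OF assms has_derivative_add[OF G_has_derivative[OF assms] G_has_derivative[OF assms]]])
     (simp_all add: bilinear_ladd[OF bil])

lemma dG_scale_left:
  assumes "x \<in> S"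
  shows "dG x (c *\<^sub>R v) w d = c * dG x v w d"
  by (subst dG_eqI[OF assms has_derivative_mult_right[OF G_has_derivative[OF assms]]])
     (simp_all add: bilinear_lmul[OF bil])

lemma dG_add_right: "x \<in> S \<Longrightarrow> dG x w (v + v') d = dG x w v d + dG x w v' d"
  by (metis dG_add_left dG_sym)

lemma dG_scale_right: "x \<in> S \<Longrightarrow> dG x w (c *\<^sub>R v) d = c * dG x w v d"
  by (metis dG_scale_left dG_sym)

lemmas dG_simps = dG_linear dG_add_left dG_scale_left dG_add_right dG_scale_right

lemma linear_koszul: "x \<in> S \<Longrightarrow> linear (koszul G x v w)"
  by (rule linearI) (simp_all add: koszul_def dG_simps algebra_simps diff_divide_distrib add_divide_distrib)

lemma G_christoffel:
  assumes x: "x \<in> S"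
  shows "G x (christoffel G x v w) y = koszul G x v w y"
proof -
  obtain z where z: "\<And>y. G x z y = koszul G x v w y"
    using bilinear_form_represents[OF bil[OF x] nondeg[OF x] linear_koszul[OF x]] by blast
  from christoffel_eqI[OF bil[OF x] nondeg[OF x] z] have "christoffel G x v w = z" .
  with z show ?thesis by simp
qed

text \<open>Nondegeneracy reduces each algebraic law of \<open>christoffel\<close> to its lowered
  form, where it follows from the corresponding law of \<open>koszul\<close>.\<close>

lemma christoffel_unique:
  assumes "x \<in> S" "\<And>y. G x z y = koszul G x v w y"
  shows "christoffel G x v w = z"
  using assms by (intro christoffel_eqI bil) (auto intro: nondeg)

lemma christoffel_sym: "x \<in> S \<Longrightarrow> christoffel G x v w = christoffel G x w v"
  by (rule christoffel_unique) (simp_all add: G_christoffel koszul_def dG_sym[of x v w])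

lemma christoffel_add_right:
  "x \<in> S \<Longrightarrow> christoffel G x v (w + w') = christoffel G x v w + christoffel G x v w'"
  by (rule christoffel_unique)
     (simp_all add: bilinear_ladd[OF bil] G_christoffel koszul_def dG_simps field_simps)

lemma christoffel_scale_right:
  "x \<in> S \<Longrightarrow> christoffel G x v (c *\<^sub>R w) = c *\<^sub>R christoffel G x v w"
  by (rule christoffel_unique)
     (simp_all add: bilinear_lmul[OF bil] G_christoffel koszul_def dG_simps field_simps)

lemma christoffel_add_left:
  "x \<in> S \<Longrightarrow> christoffel G x (w + w') v = christoffel G x w v + christoffel G x w' v"
  by (metis christoffel_add_right christoffel_sym)

lemma christoffel_scale_left:
  "x \<in> S \<Longrightarrow> christoffel G x (c *\<^sub>R w) v = c *\<^sub>R christoffel G x w v"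
  by (metis christoffel_scale_right christoffel_sym)

lemma christoffel_zero:
  assumes "x \<in> S"
  shows "christoffel G x 0 v = 0" "christoffel G x v 0 = 0"
  using christoffel_scale_left[OF assms, of 0] christoffel_scale_right[OF assms, of _ 0] by auto

text \<open>The linear system solved by \<open>christoffel\<close> has the metric as coefficients
  and \<open>koszul\<close> as right-hand side. The latter is built from first derivatives of
  \<open>G\<close>, which smoothness makes differentiable again.\<close>

lemma christoffel_has_derivative:
  assumes x: "x \<in> S"
  shows "((\<lambda>p. christoffel G p v w) has_derivative
    frechet_derivative (\<lambda>p. christoffel G p v w) (at x)) (at x)"
proof -
  have "(\<lambda>p. christoffel G p v w) differentiable (at x)"
  proof (rule differentiable_linear_solve[OF S_open x bil nondeg[OF x], where f = "\<lambda>p. koszul G p v w"])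
    show "(\<lambda>p. G p v w) differentiable at x" for v w
      using G_has_derivative[OF x] by (rule differentiableI)
    show "(\<lambda>p. koszul G p v w y) differentiable at x" for y
    proof -
      have "(\<lambda>p. inverse 2 * (dG p w y v + dG p v y w - dG p v w y)) differentiable at x"
        by (intro differentiable_mult differentiable_add differentiable_diff differentiable_const
            dG_differentiable x)
      then show ?thesis by (simp add: koszul_def field_simps)
    qed
  qed (auto simp: G_christoffel)
  then show ?thesis by (simp add: frechet_derivative_works)
qed

end


section \<open>Curvature of doubly warped metrics\<close>

definition warped ::
  "(real \<Rightarrow> real) \<Rightarrow> (real \<Rightarrow> real) \<Rightarrow> (real \<Rightarrow> real) \<Rightarrow> 'e::euclidean_space local_metric
     \<Rightarrow> (real \<times> real \<times> 'e) local_metric" where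
  "warped P Q W G = (\<lambda>(s, y, x) (a, b, v) (a', b', v').
     P s * (a * a') + Q s * (b * b') + W s * G x v v')"

lemma warped_simp [simp]:
  "warped P Q W G (s, y, x) (a, b, v) (a', b', v') = P s * (a * a') + Q s * (b * b') + W s * G x v v'"
  by (simp add: warped_def)

lemma bilinear_warped:
  assumes "bilinear (G x)"
  shows "bilinear (warped P Q W G (s, y, x))"
  unfolding bilinear_def
  by (auto intro!: linearI simp: bilinear_ladd[OF assms] bilinear_radd[OF assms]
      bilinear_lmul[OF assms] bilinear_rmul[OF assms] algebra_simps split_paired_all)

lemma warped_nondegenerate:
  assumes "bilinear (G x)" and nondeg: "\<And>v. (\<And>w. G x v w = 0) \<Longrightarrow> v = 0"
    and "P s \<noteq> 0" "Q s \<noteq> 0" "W s \<noteq> 0" and 0: "\<And>Y. warped P Q W G (s, y, x) V Y = 0"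
  shows "V = 0"
proof -
  obtain a b v where V: "V = (a, b, v)" by (cases V)
  have "G x v 0 = 0" "\<And>w. G x 0 w = 0" using bilinear_rzero[OF assms(1)] bilinear_lzero[OF assms(1)] by auto
  then have "a = 0" "b = 0" using 0[of "(1, 0, 0)"] 0[of "(0, 1, 0)"] assms(3,4) by (auto simp: V)
  moreover have "G x v w = 0" for w using 0[of "(0, 0, w)"] assms(5) by (simp add: V)
  ultimately show ?thesis using nondeg[of v] by (simp add: V zero_prod_def)
qed

lemma sum_Basis_Pair:
  "(\<Sum>z\<in>Basis. f z) = (\<Sum>u\<in>Basis. f (u, 0)) + (\<Sum>v\<in>Basis. f (0, v))"
  unfolding Basis_prod_def
  by (subst sum.union_disjoint) (auto simp: sum.reindex inj_on_def)

lemma has_derivative_fst_compose: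
  assumes "(f has_real_derivative f') (at s)"
  shows "((\<lambda>p. f (fst p)) has_derivative (\<lambda>d. f' * fst d)) (at (s, z))"
  using has_derivative_compose[of fst fst "(s, z)" UNIV f "(*) f'"]
    has_derivative_fst[OF has_derivative_ident, of "at (s, z)"] assms
  by (simp add: has_field_derivative_def)

lemma has_derivative_snd_snd_compose:
  assumes "(f has_derivative f') (at x)"
  shows "((\<lambda>p. f (snd (snd p))) has_derivative (\<lambda>d. f' (snd (snd d)))) (at (s, y, x))"
  using has_derivative_compose[of "\<lambda>p. snd (snd p)" "\<lambda>p. snd (snd p)" "(s, y, x)" UNIV f f']
    has_derivative_snd[OF has_derivative_snd[OF has_derivative_ident, of "at (s, y, x)"]] assms
  by simp

text \<open>\<open>p\<close>, \<open>q\<close>, \<open>w\<close> are the halved logarithmic derivatives of \<open>P\<close>, \<open>Q\<close>, \<open>W\<close>.\<close>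

locale warped_metric = local_metric S G for S :: "'e::euclidean_space set" and G +
  fixes P Q W p q w p' q' w' :: "real \<Rightarrow> real"
  assumes P_deriv: "s > 0 \<Longrightarrow> (P has_real_derivative 2 * P s * p s) (at s)"
    and Q_deriv: "s > 0 \<Longrightarrow> (Q has_real_derivative 2 * Q s * q s) (at s)"
    and W_deriv: "s > 0 \<Longrightarrow> (W has_real_derivative 2 * W s * w s) (at s)"
    and p_deriv: "s > 0 \<Longrightarrow> (p has_real_derivative p' s) (at s)"
    and q_deriv: "s > 0 \<Longrightarrow> (q has_real_derivative q' s) (at s)"
    and w_deriv: "s > 0 \<Longrightarrow> (w has_real_derivative w' s) (at s)"
    and P_nz: "s > 0 \<Longrightarrow> P s \<noteq> 0" and Q_nz: "s > 0 \<Longrightarrow> Q s \<noteq> 0" and W_nz: "s > 0 \<Longrightarrow> W s \<noteq> 0"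
begin

abbreviation "N \<equiv> warped P Q W G"

section \<open>Christoffel symbols of the warped metric\<close>

lemma dN:
  assumes "s > 0" "x \<in> S"
  shows "frechet_derivative (\<lambda>z. N z (a, b, v) (a', b', v')) (at (s, y, x)) (c, d, u) =
    2 * P s * p s * c * (a * a') + 2 * Q s * q s * c * (b * b') + 2 * W s * w s * c * G x v v'
      + W s * dG x v v' u"
proof -
  have "((\<lambda>z. P (fst z) * (a * a') + Q (fst z) * (b * b') + W (fst z) * G (snd (snd z)) v v') has_derivative
    (\<lambda>t. 2 * P s * p s * fst t * (a * a') + 2 * Q s * q s * fst t * (b * b') +
      2 * W s * w s * fst t * G x v v' + W s * dG x v v' (snd (snd t)))) (at (s, y, x))"
    by (rule derivative_eq_intros has_derivative_fst_compose[OF P_deriv[OF assms(1)]]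
        has_derivative_fst_compose[OF Q_deriv[OF assms(1)]] has_derivative_fst_compose[OF W_deriv[OF assms(1)]]
        has_derivative_snd_snd_compose[OF G_has_derivative[OF assms(2)]] refl)+
       (simp add: algebra_simps)
  from frechet_derivative_at[OF this, symmetric] show ?thesis
    by (simp add: warped_def case_prod_unfold)
qed

text \<open>Found by solving the Koszul formula component by component. As \<open>Q s * q s\<close>
  and \<open>W s * w s\<close> are Q'/2 and W'/2, the first component contains the usual terms
  Q'/(2P) and W'/(2P).\<close>

definition \<Gamma> :: "real \<times> real \<times> 'e \<Rightarrow> real \<times> real \<times> 'e \<Rightarrow> real \<times> real \<times> 'e \<Rightarrow> real \<times> real \<times> 'e" where
  "\<Gamma> = (\<lambda>(s, y, x) (a, b, v) (a', b', v').
     (p s * (a * a') - Q s * q s / P s * (b * b') - W s * w s / P s * G x v v',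
      q s * (a * b' + a' * b),
      w s *\<^sub>R (a *\<^sub>R v' + a' *\<^sub>R v) + christoffel G x v v'))"

lemma christoffel_warped:
  assumes "s > 0" "x \<in> S"
  shows "christoffel N (s, y, x) V V' = \<Gamma> (s, y, x) V V'"
proof (rule christoffel_eqI)
  fix Y :: "real \<times> real \<times> 'e"
  obtain a b v a' b' v' c d u where *: "V = (a, b, v)" "V' = (a', b', v')" "Y = (c, d, u)"
    by (cases V, cases V', cases Y)
  have e: "G x (w s *\<^sub>R (a *\<^sub>R v' + a' *\<^sub>R v) + christoffel G x v v') u =
     w s * (a * G x v' u + a' * G x v u) + koszul G x v v' u"
    using assms(2) by (simp add: bilinear_ladd[OF bil] bilinear_lmul[OF bil] G_christoffel)
  show "N (s, y, x) (\<Gamma> (s, y, x) V V') Y = koszul N (s, y, x) V V' Y"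
    unfolding * koszul_def \<Gamma>_def using P_nz[OF assms(1)]
    by (simp add: dN assms e, simp add: koszul_def field_simps)
next
  show "bilinear (N (s, y, x))" using assms(2) by (intro bilinear_warped bil)
  show "V = 0" if "\<And>Y. N (s, y, x) V Y = 0" for V
    using that assms P_nz Q_nz W_nz nondeg
    by (intro warped_nondegenerate[of G x P s Q W y V, OF bil]) blast+
qed

text \<open>Logarithmic differentiation: Q/P has logarithmic derivative 2 (q - p). Keeping Q/P as a
  factor leaves only polynomials in the halved logarithmic derivatives and their
  derivatives.\<close>

lemma Qq_over_P_deriv:
  assumes "s > 0"
  shows "((\<lambda>s. Q s * q s / P s) has_real_derivative Q s / P s * (q' s + 2 * q s * (q s - p s))) (at s)"
  using P_nz[OF assms]
  by (auto intro!: derivative_eq_intros P_deriv[OF assms] Q_deriv[OF assms] q_deriv[OF assms]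
      simp: field_simps power2_eq_square)

lemma Ww_over_P_deriv:
  assumes "s > 0"
  shows "((\<lambda>s. W s * w s / P s) has_real_derivative W s / P s * (w' s + 2 * w s * (w s - p s))) (at s)"
  using P_nz[OF assms]
  by (auto intro!: derivative_eq_intros P_deriv[OF assms] W_deriv[OF assms] w_deriv[OF assms]
      simp: field_simps power2_eq_square)

abbreviation d\<Gamma>_G :: "'e \<Rightarrow> 'e \<Rightarrow> 'e \<Rightarrow> 'e \<Rightarrow> 'e" where
  "d\<Gamma>_G x v v' \<equiv> frechet_derivative (\<lambda>p. christoffel G p v v') (at x)"

lemma dchristoffel_warped:
  assumes "s > 0" "x \<in> S"
  shows "frechet_derivative (\<lambda>z. christoffel N z (a, b, v) (a', b', v')) (at (s, y, x)) (c, d, u) =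
    (p' s * c * (a * a') - Q s / P s * (q' s + 2 * q s * (q s - p s)) * c * (b * b')
       - W s / P s * (w' s + 2 * w s * (w s - p s)) * c * G x v v' - W s * w s / P s * dG x v v' u,
     q' s * c * (a * b' + a' * b),
     (w' s * c) *\<^sub>R (a *\<^sub>R v' + a' *\<^sub>R v) + d\<Gamma>_G x v v' u)"
proof -
  let ?f = "\<lambda>z. (p (fst z) * (a * a') - Q (fst z) * q (fst z) / P (fst z) * (b * b')
       - W (fst z) * w (fst z) / P (fst z) * G (snd (snd z)) v v',
     q (fst z) * (a * b' + a' * b),
     w (fst z) *\<^sub>R (a *\<^sub>R v' + a' *\<^sub>R v) + christoffel G (snd (snd z)) v v')"
  let ?f' = "\<lambda>t. (p' s * fst t * (a * a') - Q s / P s * (q' s + 2 * q s * (q s - p s)) * fst t * (b * b')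
       - W s / P s * (w' s + 2 * w s * (w s - p s)) * fst t * G x v v' - W s * w s / P s * dG x v v' (snd (snd t)),
     q' s * fst t * (a * b' + a' * b),
     (w' s * fst t) *\<^sub>R (a *\<^sub>R v' + a' *\<^sub>R v) + d\<Gamma>_G x v v' (snd (snd t)))"
  have "(?f has_derivative ?f') (at (s, y, x))"
    by (rule derivative_eq_intros has_derivative_fst_compose[OF p_deriv[OF assms(1)]]
        has_derivative_fst_compose[OF Qq_over_P_deriv[OF assms(1)]]
        has_derivative_fst_compose[OF Ww_over_P_deriv[OF assms(1)]]
        has_derivative_fst_compose[OF q_deriv[OF assms(1)]]
        has_derivative_fst_compose[OF w_deriv[OF assms(1)]]
        has_derivative_snd_snd_compose[OF G_has_derivative[OF assms(2)]]
        has_derivative_snd_snd_compose[OF christoffel_has_derivative[OF assms(2)]] refl)+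
       (simp add: fun_eq_iff algebra_simps)
  \<comment> \<open>The closed form of the Christoffel symbols holds only over s > 0 and
    \<open>S\<close>; this set is open, so the derivative does not change.\<close>
  then have "((\<lambda>z. christoffel N z (a, b, v) (a', b', v')) has_derivative ?f') (at (s, y, x))"
  proof (rule has_derivative_transform_within_open)
    show "open ({0::real<..} \<times> UNIV \<times> S)" by (intro open_Times S_open open_greaterThan open_UNIV)
    show "?f z = christoffel N z (a, b, v) (a', b', v')" if "z \<in> {0<..} \<times> UNIV \<times> S" for z
      using that by (auto simp: christoffel_warped \<Gamma>_def)
  qed (use assms in auto)
  from frechet_derivative_at[OF this, symmetric] show ?thesis by simp
qed

lemma dG_zero [simp]: "x \<in> S \<Longrightarrow> dG x v v' 0 = 0"
  using dG_linear(2)[of x v v' 0 0] by simp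

lemma dG_zero_left [simp]: "x \<in> S \<Longrightarrow> dG x 0 v u = 0"
  using dG_scale_left[of x 0 0] by simp

lemma d\<Gamma>_G_zero [simp]: "x \<in> S \<Longrightarrow> d\<Gamma>_G x v v' 0 = 0"
  using linear_0[OF has_derivative_linear[OF christoffel_has_derivative]] by simp

lemma G_zero [simp]: "x \<in> S \<Longrightarrow> G x 0 v = 0" "x \<in> S \<Longrightarrow> G x v 0 = 0"
  using bilinear_lzero[OF bil] bilinear_rzero[OF bil] by blast+

lemmas bilinear_simps = christoffel_zero christoffel_add_left christoffel_add_right
  christoffel_scale_left christoffel_scale_right bilinear_ladd[OF bil] bilinear_radd[OF bil]
  bilinear_lmul[OF bil] bilinear_rmul[OF bil]

text \<open>The trace in \<open>ricci\<close> needs R(z,V)V' only along z itself, for z in the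
  directions of s, y and the fibre; these are the three components computed here and below.\<close>

lemma curvature_warped_s:
  assumes "s > 0" "x \<in> S"
  shows "fst (curvature N (s, y, x) (1, 0, 0) (a, b, v) (a', b', v')) =
    Q s / P s * (q s * (p s - q s) - q' s) * (b * b') + W s / P s * (w s * (p s - w s) - w' s) * G x v v'"
  using P_nz[OF assms(1)]
  by (simp add: curvature_def dchristoffel_warped christoffel_warped assms \<Gamma>_def bilinear_simps)
     (simp add: field_simps)

lemma curvature_warped_y:
  assumes "s > 0" "x \<in> S"
  shows "fst (snd (curvature N (s, y, x) (0, 1, 0) (a, b, v) (a', b', v'))) =
    (q s * (p s - q s) - q' s) * (a * a') - q s * (W s * w s / P s) * G x v v'"
  using P_nz[OF assms(1)]
  by (simp add: curvature_def dchristoffel_warped christoffel_warped assms \<Gamma>_def bilinear_simps)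
     (simp add: field_simps)

text \<open>Besides the curvature of the fibre and the mixed terms in a a' and b b', there remains
  -(W w^2 / P) (G(v,v') e - G(e,v') v), a curvature tensor of constant-curvature type.\<close>

lemma curvature_warped_fibre:
  assumes "s > 0" "x \<in> S"
  shows "snd (snd (curvature N (s, y, x) (0, 0, e) (a, b, v) (a', b', v'))) =
    curvature G x e v v'
    + ((w s * (p s - w s) - w' s) * (a * a') - w s * (Q s * q s / P s) * (b * b')
        - w s * (W s * w s / P s) * G x v v') *\<^sub>R e
    + (w s * (W s * w s / P s) * G x e v') *\<^sub>R v"
  by (simp add: curvature_def dchristoffel_warped christoffel_warped assms \<Gamma>_def bilinear_simps
      christoffel_sym[of x v e] algebra_simps)

lemma ricci_warped:
  assumes "s > 0" "x \<in> S" and k: "k = real DIM('e)"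
  shows "ricci N (s, y, x) (a, b, v) (a', b', v') =
    (q s * (p s - q s) - q' s + k * (w s * (p s - w s) - w' s)) * (a * a')
    + Q s / P s * (q s * (p s - q s - k * w s) - q' s) * (b * b')
    + ricci G x v v' + W s / P s * (w s * (p s - q s - k * w s) - w' s) * G x v v'"
proof -
  let ?R = "\<lambda>z. curvature N (s, y, x) z (a, b, v) (a', b', v')"
  \<comment> \<open>Trace of the rank-one map sending z to G(z,v') v. It yields a term in w^2 that
    cancels the -w^2 coming from the s component.\<close>
  have tr: "(\<Sum>e\<in>Basis. c * G x e v' * (v \<bullet> e) / d) = c * G x v v' / d" for c d
  proof -
    have "linear (\<lambda>z. G x z v')" using bil[OF assms(2)] by (simp add: bilinear_def)
    from linear_sum[OF this, of "\<lambda>e. (v \<bullet> e) *\<^sub>R e" Basis] show ?thesis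
      by (simp add: euclidean_representation linear_scale[OF \<open>linear (\<lambda>z. G x z v')\<close>]
          sum_distrib_left sum_divide_distrib[symmetric] mult_ac)
  qed
  have "ricci N (s, y, x) (a, b, v) (a', b', v') =
    fst (?R (1, 0, 0)) + fst (snd (?R (0, 1, 0))) + (\<Sum>e\<in>Basis. snd (snd (?R (0, 0, e))) \<bullet> e)"
    unfolding ricci_def
    by (simp add: sum_Basis_Pair zero_prod_def inner_prod_def)
  also have "(\<Sum>e\<in>Basis. snd (snd (?R (0, 0, e))) \<bullet> e) =
    ricci G x v v' + k * ((w s * (p s - w s) - w' s) * (a * a') - w s * (Q s * q s / P s) * (b * b')
        - w s * (W s * w s / P s) * G x v v') + w s * (W s * w s / P s) * G x v v'"
    by (simp add: curvature_warped_fibre assms inner_add_left sum.distrib tr ricci_def k inner_Basis)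
  finally show ?thesis
    using P_nz[OF assms(1)]
    by (simp add: curvature_warped_s curvature_warped_y assms(1,2)) (simp add: field_simps)
qed

end


section \<open>Warped metrics on the total space\<close>

lemma pseudo_riemannian_local_metric:
  assumes "pseudo_riemannian F g" "i \<in> indices F"
  shows "local_metric (chart_image F i) (g i)"
proof
  show "open (chart_image F i)"
    using assms unfolding pseudo_riemannian_def smooth_manifold_def by blast
qed (use assms in \<open>unfold pseudo_riemannian_def, blast+\<close>)

lemma chart_image_total_space [simp]:
  "chart_image (total_space F) (a, b, i) = {0<..} \<times> UNIV \<times> chart_image F i"
  by (simp add: total_space_def)

lemma transition_dom_total_space [simp]:
  "transition_dom (total_space F) (a, b, i) (a', b', j) = {0<..} \<times> UNIV \<times> transition_dom F i j"
  by (simp add: total_space_def)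

lemma indices_total_space: "(a, b, i) \<in> indices (total_space F) \<longleftrightarrow> i \<in> indices F"
  by (simp add: total_space_def prod_manifold_def open_submanifold_def)

lemma smooth_manifold_total_space: "smooth_manifold F \<Longrightarrow> smooth_manifold (total_space F)"
  unfolding total_space_def
  by (intro smooth_manifold_prod smooth_manifold_open_submanifold) (auto simp: gt_ex)

lemma transition_total_space:
  assumes "smooth_manifold F" "i \<in> indices F" "s > 0" "x \<in> transition_dom F i j"
  shows "transition (total_space F) (a, b, i) (a', b', j) (s, y, x) = (s, y, transition F i j x)"
proof -
  have R: "smooth_manifold (open_submanifold (UNIV :: real set))"
    "smooth_manifold (open_submanifold {0::real<..})"
    by (auto intro!: smooth_manifold_open_submanifold simp: gt_ex)
  have "transition (prod_manifold (open_submanifold (UNIV :: real set)) F) (b, i) (b', j) (y, x) = (y, transition F i j x)"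
    by (subst transition_prod[OF R(1) _ assms(1,2)])
       (use assms in \<open>auto simp: transition_open_submanifold, simp_all add: open_submanifold_def\<close>)
  then show ?thesis
    unfolding total_space_def
    by (subst transition_prod[OF R(2) _ smooth_manifold_prod[OF R(1) assms(1)]])
       (use assms in \<open>auto simp: transition_open_submanifold, simp_all add: open_submanifold_def prod_manifold_def\<close>)
qed

lemma frechet_derivative_transition_total_space:
  assumes "smooth_manifold F" "i \<in> indices F" "j \<in> indices F" "s > 0" "x \<in> transition_dom F i j"
  shows "frechet_derivative (transition (total_space F) (a, b, i) (a', b', j)) (at (s, y, x)) (c, d, v) =
    (c, d, frechet_derivative (transition F i j) (at x) v)"
proof -
  let ?\<tau> = "map_prod (\<lambda>s::real. s) (map_prod (\<lambda>y::real. y) (transition F i j))"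
  let ?D = "map_prod (\<lambda>s::real. s) (map_prod (\<lambda>y::real. y) (frechet_derivative (transition F i j) (at x)))"
  have "(transition F i j has_derivative frechet_derivative (transition F i j) (at x)) (at x)"
    using transition_differentiable[OF assms(1-3,5)] by (simp add: frechet_derivative_works)
  then have "(?\<tau> has_derivative ?D) (at (s, y, x))"
    by (intro has_derivative_map_prod has_derivative_ident)
  then have "(transition (total_space F) (a, b, i) (a', b', j) has_derivative ?D) (at (s, y, x))"
  proof (rule has_derivative_transform_within_open)
    show "open ({0::real<..} \<times> (UNIV::real set) \<times> transition_dom F i j)"
      by (intro open_Times open_transition_dom assms open_greaterThan open_UNIV)
  qed (use assms transition_total_space[OF assms(1,2)] in \<open>auto simp: map_prod_def\<close>)
  from frechet_derivative_at[OF this, symmetric] show ?thesis by simp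
qed

text \<open>Transition maps of the total space fix s and y, and \<open>P\<close>, \<open>Q\<close>,
  \<open>W\<close> depend only on s, so the transformation law reduces to the one of
  \<open>g\<close>.\<close>

lemma pseudo_riemannian_warped:
  fixes F :: "('a, 'e::euclidean_space, 'i) manifold"
  assumes F: "pseudo_riemannian F g"
    and smooth: "smooth_on {0<..} P" "smooth_on {0<..} Q" "smooth_on {0<..} W"
    and nz: "\<And>s. s > 0 \<Longrightarrow> P s \<noteq> 0" "\<And>s. s > 0 \<Longrightarrow> Q s \<noteq> 0" "\<And>s. s > 0 \<Longrightarrow> W s \<noteq> 0"
  shows "pseudo_riemannian (total_space F) (\<lambda>(_, _, i). warped P Q W (g i))"
proof -
  have M: "smooth_manifold F" using F by (simp add: pseudo_riemannian_def)
  have sm: "smooth_on ({0<..} \<times> UNIV \<times> chart_image F i) (\<lambda>z. warped P Q W (g i) z V V')"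
    if "i \<in> indices F" for i V V'
  proof -
    obtain a b v a' b' v' where V: "V = (a, b, v)" "V' = (a', b', v')" by (cases V, cases V')
    interpret local_metric "chart_image F i" "g i" by (rule pseudo_riemannian_local_metric[OF F that])
    let ?U = "{0::real<..} \<times> (UNIV :: real set) \<times> chart_image F i"
    have U: "open ?U" by (intro open_Times S_open open_greaterThan open_UNIV)
    have 1: "Ck_on n ?U (\<lambda>z. f (fst z))" if "smooth_on {0<..} f" for n and f :: "real \<Rightarrow> real"
      by (rule Ck_on_pre[OF U bounded_linear_fst, of "{0<..}"]) (use that in \<open>auto simp: smooth_on_def\<close>)
    have 2: "Ck_on n ?U (\<lambda>z. g i (snd (snd z)) v v')" for n
      by (rule Ck_on_pre[OF U bounded_linear_compose[OF bounded_linear_snd bounded_linear_snd], of "chart_image F i"])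
         (use smooth in \<open>auto simp: smooth_on_def\<close>)
    have "Ck_on n ?U (\<lambda>z. P (fst z) * (a * a') + Q (fst z) * (b * b') + W (fst z) * g i (snd (snd z)) v v')" for n
      by (intro Ck_on_add Ck_on_mult Ck_on_const U 1 2 assms(2-4))
    then show ?thesis
      unfolding smooth_on_def V warped_def case_prod_unfold fst_conv snd_conv by blast
  qed
  show ?thesis
    unfolding pseudo_riemannian_def
  proof (intro conjI ballI allI)
    show "smooth_manifold (total_space F)" using M by (rule smooth_manifold_total_space)
  next
    fix l V V' assume "l \<in> indices (total_space F)"
    then obtain a b i where l: "l = (a, b, i)" "i \<in> indices F" by (metis indices_total_space surj_pair)
    then show "smooth_on (chart_image (total_space F) l) (\<lambda>z. (case l of (_, _, i) \<Rightarrow> warped P Q W (g i)) z V V')"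
      using sm by simp
  next
    fix l z assume "l \<in> indices (total_space F)" and z: "z \<in> chart_image (total_space F) l"
    then obtain a b i s y x where l: "l = (a, b, i)" "i \<in> indices F" "z = (s, y, x)"
      by (metis indices_total_space surj_pair)
    then have sx: "s > 0" "x \<in> chart_image F i" using z by auto
    interpret local_metric "chart_image F i" "g i" by (rule pseudo_riemannian_local_metric[OF F l(2)])
    show "bilinear ((case l of (_, _, i) \<Rightarrow> warped P Q W (g i)) z)"
      using sx by (simp add: l bilinear_warped bil)
    show "(case l of (_, _, i) \<Rightarrow> warped P Q W (g i)) z V V' = (case l of (_, _, i) \<Rightarrow> warped P Q W (g i)) z V' V" for V V'
      using sym[OF sx(2)] by (cases V, cases V') (simp add: l mult.commute)
    show "(\<forall>V'. (case l of (_, _, i) \<Rightarrow> warped P Q W (g i)) z V V' = 0) \<longrightarrow> V = 0" for V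
      using warped_nondegenerate[of "g i" x P s Q W y V, OF bil[OF sx(2)] nondeg[OF sx(2)]] nz[OF sx(1)]
      by (auto simp: l)
  next
    fix l l' z and V V' :: "real \<times> real \<times> 'e"
    assume l: "l \<in> indices (total_space F)" "l' \<in> indices (total_space F)"
      and z: "z \<in> transition_dom (total_space F) l l'"
    obtain a b i a' b' j s y x c d v c' d' v'
      where *: "l = (a, b, i)" "l' = (a', b', j)" "z = (s, y, x)" "V = (c, d, v)" "V' = (c', d', v')"
      by (metis surj_pair)
    have i: "i \<in> indices F" "j \<in> indices F" using l by (auto simp: * indices_total_space)
    have sx: "s > 0" "x \<in> transition_dom F i j" using z by (auto simp: *)
    have "g i x v v' = g j (transition F i j x) (frechet_derivative (transition F i j) (at x) v)
        (frechet_derivative (transition F i j) (at x) v')"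
      using F i sx(2) unfolding pseudo_riemannian_def by blast
    then show "(case l of (_, _, i) \<Rightarrow> warped P Q W (g i)) z V V' =
        (case l' of (_, _, i) \<Rightarrow> warped P Q W (g i)) (transition (total_space F) l l' z)
          (frechet_derivative (transition (total_space F) l l') (at z) V)
          (frechet_derivative (transition (total_space F) l l') (at z) V')"
      by (simp add: * frechet_derivative_transition_total_space[OF M i sx] transition_total_space[OF M i(1) sx])
  qed
qed


section \<open>Metrics with a given profile\<close>

text \<open>The Ricci tensor sees two derivatives of \<open>H\<close>; they stay abstract here so
  that no formula in terms of \<open>u\<close> enters the curvature.\<close>

locale profile =
  fixes K \<epsilon> :: real and H H1 H2 :: "real \<Rightarrow> real"
  assumes K: "K \<ge> 2" and \<epsilon>: "\<epsilon> = 1 \<or> \<epsilon> = -1"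
    and H_pos: "s > 0 \<Longrightarrow> H s > 0"
    and H_deriv: "s > 0 \<Longrightarrow> (H has_real_derivative H1 s) (at s)"
    and H1_deriv: "s > 0 \<Longrightarrow> (H1 has_real_derivative H2 s) (at s)"
begin

definition "P s = s powr (1 / K - 1) / H s"
definition "Q s = \<epsilon> * s powr (1 / K - 1) * H s"
definition "W s = s powr (2 / K)"
definition "p s = ((1 / K - 1) / s - H1 s / H s) / 2"
definition "q s = ((1 / K - 1) / s + H1 s / H s) / 2"
definition "w s = 1 / (K * s)"
definition "p' s = (- (1 / K - 1) / s\<^sup>2 - (H2 s / H s - (H1 s / H s)\<^sup>2)) / 2"
definition "q' s = (- (1 / K - 1) / s\<^sup>2 + (H2 s / H s - (H1 s / H s)\<^sup>2)) / 2"
definition "w' s = - 1 / (K * s\<^sup>2)"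

section \<open>Coefficient functions of the profile metric and their derivatives\<close>

lemma powr_deriv:
  assumes "s > 0"
  shows "((\<lambda>s. s powr c) has_real_derivative c * (s powr c / s)) (at s)"
  using has_real_derivative_powr[OF assms, of c] assms by (simp add: powr_diff)

lemma nonzero:
  assumes "s > 0"
  shows "P s \<noteq> 0" "Q s \<noteq> 0" "W s \<noteq> 0"
  using assms H_pos[OF assms] \<epsilon> by (auto simp: P_def Q_def W_def)

lemma P_deriv:
  assumes "s > 0"
  shows "(P has_real_derivative 2 * P s * p s) (at s)"
  unfolding P_def p_def
  by (rule DERIV_cong[OF DERIV_divide[OF powr_deriv[OF assms] H_deriv[OF assms]]])
     (use assms H_pos[OF assms] in \<open>auto simp: field_simps\<close>)

lemma Q_deriv:
  assumes "s > 0"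
  shows "(Q has_real_derivative 2 * Q s * q s) (at s)"
  unfolding Q_def q_def
  by (rule DERIV_cong[OF DERIV_mult[OF DERIV_cmult[OF powr_deriv[OF assms]] H_deriv[OF assms]]])
     (use assms H_pos[OF assms] in \<open>auto simp: field_simps\<close>)

lemma W_deriv:
  assumes "s > 0"
  shows "(W has_real_derivative 2 * W s * w s) (at s)"
  unfolding W_def w_def
  by (rule DERIV_cong[OF powr_deriv[OF assms]]) (use assms K in \<open>auto simp: field_simps\<close>)

lemma p_deriv:
  assumes "s > 0"
  shows "(p has_real_derivative p' s) (at s)"
  unfolding p_def p'_def using assms H_pos[OF assms]
  by (auto intro!: derivative_eq_intros H_deriv H1_deriv)
     (simp add: field_simps power2_eq_square)

lemma q_deriv:
  assumes "s > 0"
  shows "(q has_real_derivative q' s) (at s)"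
  unfolding q_def q'_def using assms H_pos[OF assms]
  by (auto intro!: derivative_eq_intros H_deriv H1_deriv)
     (simp add: field_simps power2_eq_square)

lemma w_deriv:
  assumes "s > 0"
  shows "(w has_real_derivative w' s) (at s)"
  unfolding w_def w'_def using assms K
  by (auto intro!: derivative_eq_intros) (simp add: field_simps power2_eq_square)

lemma base_coefficient_s:
  assumes "s > 0"
  shows "q s * (p s - q s) - q' s + K * (w s * (p s - w s) - w' s) = - (H2 s + H1 s / (K * s)) / (2 * H s)"
  using assms K H_pos[OF assms]
  by (simp add: p_def q_def w_def q'_def w'_def field_simps power2_eq_square)

text \<open>The coefficient for s exceeds this one by K (w (p + q - w) - w'). Since p + q = (1/K -
  1)/s and w = 1/(K s), that difference is zero; this is where the exponent 1/K - 1 in the metric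
  comes from.\<close>

lemma base_coefficient_y:
  assumes "s > 0"
  shows "q s * (p s - q s - K * w s) - q' s = - (H2 s + H1 s / (K * s)) / (2 * H s)"
  using assms K H_pos[OF assms]
  by (simp add: p_def q_def w_def q'_def field_simps power2_eq_square)

text \<open>Here p - q = -H1/H, while the terms free of H1 cancel because w' = -K w^2. The remaining
  1/H cancels against the factor H in W/P, which makes the result linear in H1.\<close>

lemma fibre_coefficient:
  assumes "s > 0"
  shows "W s / P s * (w s * (p s - q s - K * w s) - w' s) = - (s powr (1 / K) * H1 s / K)"
proof -
  have "w s * (p s - q s - K * w s) - w' s = - H1 s / (H s * K * s)"
    using assms K H_pos[OF assms]
    by (simp add: p_def q_def w_def w'_def field_simps power2_eq_square)
  moreover have "s powr (2 / K) = s powr (1 / K) * s powr (1 / K)"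
    by (simp add: powr_add[symmetric])
  then have "W s / P s = s powr (1 / K) * s * H s"
    using assms H_pos[OF assms] by (simp add: W_def P_def powr_diff)
  ultimately show ?thesis using assms K H_pos[OF assms] by simp
qed

lemma ricci_profile:
  assumes "local_metric S (G :: 'e::euclidean_space local_metric)" and K_dim: "K = real DIM('e)"
    and s: "s > 0" and x: "x \<in> S"
  shows "ricci (warped P Q W G) (s, y, x) (a, b, v) (a', b', v') =
    - (H2 s + H1 s / (K * s)) / (2 * H s) * (a * a' + Q s / P s * (b * b'))
    + ricci G x v v' - s powr (1 / K) * H1 s / K * G x v v'"
proof -
  interpret local_metric S G by fact
  interpret warped_metric S G P Q W p q w p' q' w'
    by unfold_locales (auto intro: P_deriv Q_deriv W_deriv p_deriv q_deriv w_deriv simp: nonzero)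
  show ?thesis
    unfolding ricci_warped[OF s x K_dim] base_coefficient_s[OF s] base_coefficient_y[OF s] fibre_coefficient[OF s]
    by (simp add: algebra_simps)
qed

end


section \<open>The profile equation\<close>

lemma smooth_on_real_derivative:
  fixes f :: "real \<Rightarrow> real"
  assumes "smooth_on S f"
  obtains f' where "smooth_on S f'" "\<And>s. s \<in> S \<Longrightarrow> (f has_real_derivative f' s) (at s)"
proof
  have Ck: "Ck_on (Suc n) S f" for n using assms by (simp add: smooth_on_def)
  show "smooth_on S (\<lambda>s. frechet_derivative f (at s) 1)"
    unfolding smooth_on_def using Ck_on_frechet_derivative[OF Ck] by blast
  show "(f has_real_derivative frechet_derivative f (at s) 1) (at s)" if "s \<in> S" for s
  proof -
    have "f differentiable (at s)" using Ck[of 0] that by (simp only: Ck_on.simps(2))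
    then obtain D where D: "(f has_real_derivative D) (at s)" by (metis real_differentiableE)
    then have "D = frechet_derivative f (at s) 1"
      using frechet_derivative_at[of f "(*) D" s] by (metis has_field_derivative_def mult.right_neutral)
    with D show ?thesis by simp
  qed
qed

text \<open>An antiderivative of the right-hand side of the first order equation for H. At K = 1 the
  term in \<nu> would have to be a logarithm.\<close>

definition \<Phi> :: "real \<Rightarrow> real \<Rightarrow> real \<Rightarrow> real \<Rightarrow> real" where
  "\<Phi> K \<nu> lam s = K * (\<nu> * (s powr (1 - 1 / K) / (1 - 1 / K)) - lam * (s powr (1 + 1 / K) / (1 + 1 / K)))"

lemma \<Phi>_deriv:
  assumes "K \<ge> 2" "s > 0"
  shows "(\<Phi> K \<nu> lam has_real_derivative K * (\<nu> * s powr (- 1 / K) - lam * s powr (1 / K))) (at s)"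
proof -
  have "1 - 1 / K \<noteq> 0" "1 + 1 / K \<noteq> 0" using assms by (auto simp: field_simps)
  then show ?thesis
    unfolding \<Phi>_def
    by (intro DERIV_cong[OF DERIV_cmult[OF DERIV_diff[OF
        DERIV_cmult[OF DERIV_cdivide[OF has_real_derivative_powr[OF assms(2)]]]
        DERIV_cmult[OF DERIV_cdivide[OF has_real_derivative_powr[OF assms(2)]]]]]]) auto
qed

lemma \<Phi>_smooth: "Ck_on n {0<..} (\<Phi> K \<nu> lam)"
proof -
  have "Ck_on n {0<..} (\<lambda>s. K * \<nu> * inverse (1 - 1 / K) * s powr (1 - 1 / K)
      + (- K * lam * inverse (1 + 1 / K)) * s powr (1 + 1 / K))"
    by (intro Ck_on_add Ck_on_mult Ck_on_const Ck_on_powr open_greaterThan)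
  then show ?thesis by (rule Ck_on_cong[OF open_greaterThan, rotated]) (simp add: \<Phi>_def field_simps)
qed

text \<open>Matches the constants of the statement with those of \<open>\<Phi>\<close>: the
  difference of squares supplies the denominators of integration and the 4 from H(s) = 4 sqrt(s)
  u(sqrt s)^2.\<close>

lemma inverse_one_minus_square:
  fixes K :: real
  assumes "K \<ge> 2"
  shows "inverse (1 - (1 + 2 / K)\<^sup>2) = - (K / (4 * (1 + 1 / K)))"
    "inverse (1 - (1 - 2 / K)\<^sup>2) = K / (4 * (1 - 1 / K))"
proof -
  have "1 - (1 + 2 / K)\<^sup>2 = - (4 * (1 + 1 / K) / K)" "1 - (1 - 2 / K)\<^sup>2 = 4 * (1 - 1 / K) / K"
    using assms by (auto simp: field_simps power2_eq_square)
  then show "inverse (1 - (1 + 2 / K)\<^sup>2) = - (K / (4 * (1 + 1 / K)))"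
    "inverse (1 - (1 - 2 / K)\<^sup>2) = K / (4 * (1 - 1 / K))"
    by simp_all
qed

lemma solution_substitution:
  fixes K r :: real
  assumes "K \<ge> 2" "r > 0"
  shows "4 * r * (lam * inverse (1 - (1 + 2 / K)\<^sup>2) * r powr (1 + 2 / K)
      + \<nu> * inverse (1 - (1 - 2 / K)\<^sup>2) * r powr (1 - 2 / K) + C * (1 / r)) = \<Phi> K \<nu> lam (r\<^sup>2) + 4 * C"
proof -
  have "(r\<^sup>2) powr c = r powr (2 * c)" for c
    using assms(2) powr_powr[of r 2 c] by simp
  moreover have "r powr (2 * (1 + 1 / K)) = r * r powr (1 + 2 / K)"
    "r powr (2 * (1 - 1 / K)) = r * r powr (1 - 2 / K)"
    using assms(2) powr_add[of r 1 "1 + 2 / K"] powr_add[of r 1 "1 - 2 / K"] by (simp_all add: algebra_simps)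
  moreover define A B where "A = 1 + 1 / K" and "B = 1 - 1 / K"
  moreover have "A \<noteq> 0" "B \<noteq> 0" using assms(1) by (auto simp: A_def B_def field_simps)
  ultimately show ?thesis
    using assms(2) unfolding inverse_one_minus_square[OF assms(1)] \<Phi>_def A_def[symmetric] B_def[symmetric]
    by (simp add: field_simps)
qed

lemma solution_iff:
  fixes K :: real
  assumes K: "K \<ge> 2"
  shows "(\<exists>C. \<forall>r>0. (u r)\<^sup>2 = lam * inverse (1 - (1 + 2 / K)\<^sup>2) * r powr (1 + 2 / K)
      + \<nu> * inverse (1 - (1 - 2 / K)\<^sup>2) * r powr (1 - 2 / K) + C * (1 / r)) \<longleftrightarrow>
    (\<exists>C. \<forall>s>0. 4 * sqrt s * (u (sqrt s))\<^sup>2 = \<Phi> K \<nu> lam s + C)" (is "(\<exists>C. \<forall>r>0. (u r)\<^sup>2 = ?f C r) \<longleftrightarrow> _")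
proof
  assume "\<exists>C. \<forall>r>0. (u r)\<^sup>2 = ?f C r"
  then obtain C where C: "\<And>r. r > 0 \<Longrightarrow> (u r)\<^sup>2 = ?f C r" by blast
  have "4 * sqrt s * (u (sqrt s))\<^sup>2 = \<Phi> K \<nu> lam s + 4 * C" if "s > 0" for s
    using that solution_substitution[OF K, of "sqrt s"] by (subst C) auto
  then show "\<exists>C. \<forall>s>0. 4 * sqrt s * (u (sqrt s))\<^sup>2 = \<Phi> K \<nu> lam s + C" by blast
next
  assume "\<exists>C. \<forall>s>0. 4 * sqrt s * (u (sqrt s))\<^sup>2 = \<Phi> K \<nu> lam s + C"
  then obtain C where C: "\<And>s. s > 0 \<Longrightarrow> 4 * sqrt s * (u (sqrt s))\<^sup>2 = \<Phi> K \<nu> lam s + C" by blast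
  \<comment> \<open>Multiplying by 4 r turns the term C / r into the constant 4 C, hence the
    quarter.\<close>
  have "(u r)\<^sup>2 = ?f (C / 4) r" if "r > 0" for r
  proof -
    have "4 * r * (u r)\<^sup>2 = 4 * r * ?f (C / 4) r"
      using that C[of "r\<^sup>2"] by (subst solution_substitution[OF K that]) simp
    then show ?thesis using that by (simp only: mult_cancel_left) auto
  qed
  then show "\<exists>C. \<forall>r>0. (u r)\<^sup>2 = ?f C r" by blast
qed

lemma ode_iff:
  fixes H H1 :: "real \<Rightarrow> real"
  assumes K: "K \<ge> 2" and H: "\<And>s. s > 0 \<Longrightarrow> (H has_real_derivative H1 s) (at s)"
  shows "(\<exists>C. \<forall>s>0. H s = \<Phi> K \<nu> lam s + C) \<longleftrightarrow>
    (\<forall>s>0. H1 s = K * (\<nu> * s powr (- 1 / K) - lam * s powr (1 / K)))" (is "_ \<longleftrightarrow> (\<forall>s>0. H1 s = ?h s)")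
proof
  assume "\<exists>C. \<forall>s>0. H s = \<Phi> K \<nu> lam s + C"
  then obtain C where C: "\<And>s. s > 0 \<Longrightarrow> H s = \<Phi> K \<nu> lam s + C" by blast
  have "(H has_real_derivative ?h s) (at s)" if "s > 0" for s
  proof (rule has_field_derivative_transform_within_open[of "\<lambda>s. \<Phi> K \<nu> lam s + C" _ _ "{0<..}"])
    show "((\<lambda>s. \<Phi> K \<nu> lam s + C) has_real_derivative ?h s) (at s)"
      using DERIV_add[OF \<Phi>_deriv[OF K that] DERIV_const] by simp
  qed (use that C in auto)
  then show "\<forall>s>0. H1 s = ?h s" using H DERIV_unique by blast
next
  assume *: "\<forall>s>0. H1 s = ?h s"
  have "((\<lambda>s. H s - \<Phi> K \<nu> lam s) has_real_derivative 0) (at s within {0<..})" if "s \<in> {0<..}" for s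
    using DERIV_diff[OF H[of s] \<Phi>_deriv[OF K, of s \<nu> lam]] that *
    by (auto intro: has_field_derivative_at_within)
  \<comment> \<open>The half-line is convex, so one constant serves all \<open>s\<close>.\<close>
  then obtain C where "\<And>s. s \<in> {0<..} \<Longrightarrow> H s - \<Phi> K \<nu> lam s = C"
    using has_field_derivative_zero_constant[of "{0<..}" "\<lambda>s. H s - \<Phi> K \<nu> lam s"] convex_real_interval by metis
  then show "\<exists>C. \<forall>s>0. H s = \<Phi> K \<nu> lam s + C"
    by (intro exI[of _ C]) (force simp: algebra_simps)
qed

text \<open>The power s^(1/K) is an integrating factor: times it, the left-hand side is the
  derivative of s^(1/K) H1, which equals K (\<nu> - lam s^(2/K)) by the equation for
  \<open>H1\<close>. So \<nu> drops out.\<close>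

lemma ode_derivative:
  fixes H1 H2 :: "real \<Rightarrow> real"
  assumes K: "K \<ge> 2" and "s > 0"
    and H1: "\<And>s. s > 0 \<Longrightarrow> H1 s = K * (\<nu> * s powr (- 1 / K) - lam * s powr (1 / K))"
    and H2: "(H1 has_real_derivative H2 s) (at s)"
  shows "H2 s + H1 s / (K * s) = - 2 * lam * s powr (1 / K - 1)"
proof -
  let ?D = "K * (\<nu> * (- 1 / K * s powr (- 1 / K - 1)) - lam * (1 / K * s powr (1 / K - 1)))"
  have "(H1 has_real_derivative ?D) (at s)"
  proof (rule has_field_derivative_transform_within_open)
    show "((\<lambda>s. K * (\<nu> * s powr (- 1 / K) - lam * s powr (1 / K))) has_real_derivative ?D) (at s)"
      by (intro DERIV_cmult DERIV_diff has_real_derivative_powr \<open>s > 0\<close>)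
  qed (use H1 \<open>s > 0\<close> in \<open>auto intro!: open_greaterThan[of 0]\<close>)
  then have D: "H2 s = ?D" using H2 DERIV_unique by blast
  have e: "s powr (- 1 / K - 1) = s powr (- 1 / K) / s" "s powr (1 / K - 1) = s powr (1 / K) / s"
    using \<open>s > 0\<close> by (simp_all add: powr_diff)
  show ?thesis
    unfolding D H1[OF \<open>s > 0\<close>] e using K \<open>s > 0\<close> by (simp add: field_simps)
qed

lemma powr_inverse_cancel:
  fixes s K :: real
  assumes "s > 0"
  shows "s powr (1 / K) * s powr (- 1 / K) = 1" "s powr (1 / K) * s powr (1 / K) = s powr (2 / K)"
    "s powr (- 1 / K) * s powr (2 / K) = s powr (1 / K)"
  using assms by (simp_all add: powr_add[symmetric] diff_divide_distrib[symmetric] add_divide_distrib[symmetric])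


section \<open>The Einstein condition\<close>

theorem mainTheorem7:
  fixes F :: "('a, 'e::euclidean_space, 'i) manifold"
    and gF :: "'i \<Rightarrow> 'e local_metric"
    and k :: nat
    and \<nu> lam \<epsilon> :: real
    and u :: "real \<Rightarrow> real"
  assumes "DIM('e) = k" and "k \<ge> 2"
    and "einstein F gF \<nu>"
    and "smooth_on {0<..} u" and "\<And>r. r > 0 \<Longrightarrow> u r > 0"
    and "\<epsilon> = 1 \<or> \<epsilon> = -1"
  shows "einstein (total_space F) (total_metric \<epsilon> u gF) lam \<longleftrightarrow>
    (\<exists>C::real. \<forall>r>0. (u r)\<^sup>2 =
        lam * inverse (1 - (1 + 2 / real k)\<^sup>2) * r powr (1 + 2 / real k)
      + \<nu> * inverse (1 - (1 - 2 / real k)\<^sup>2) * r powr (1 - 2 / real k)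
      + C * (1 / r))"
proof -
  define K where "K = real k"
  have K: "K \<ge> 2" using assms(2) by (simp add: K_def)
  have dim: "K = real DIM('e)" using assms(1) by (simp add: K_def)
  obtain u1 where u1: "smooth_on {0<..} u1" "\<And>s. s \<in> {0<..} \<Longrightarrow> (u has_real_derivative u1 s) (at s)"
    using smooth_on_real_derivative[OF assms(4)] by blast
  obtain u2 where u2: "\<And>s. s \<in> {0<..} \<Longrightarrow> (u1 has_real_derivative u2 s) (at s)"
    using smooth_on_real_derivative[OF u1(1)] by blast
  define H where "H s = 4 * sqrt s * (u (sqrt s))\<^sup>2" for s
  define H1 where "H1 s = 2 * (u (sqrt s))\<^sup>2 / sqrt s + 4 * u (sqrt s) * u1 (sqrt s)" for s
  have u_sqrt: "((\<lambda>s. u (sqrt s)) has_real_derivative u1 (sqrt s) * (inverse (sqrt s) / 2)) (at s)"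
    and u1_sqrt: "((\<lambda>s. u1 (sqrt s)) has_real_derivative u2 (sqrt s) * (inverse (sqrt s) / 2)) (at s)"
    if "s > 0" for s
    by (rule DERIV_chain2[OF _ DERIV_real_sqrt[OF that]], use that u1(2) u2 in simp)+
  have H_deriv: "(H has_real_derivative H1 s) (at s)" if "s > 0" for s
    unfolding H_def H1_def
    using that by (auto intro!: derivative_eq_intros u_sqrt) (simp add: field_simps power2_eq_square)
  \<comment> \<open>Existence of the second derivative is enough; its value will be read off from
    the differential equation by uniqueness of derivatives.\<close>
  have "\<exists>D. (H1 has_real_derivative D) (at s)" if "s > 0" for s
    unfolding H1_def
    by (rule exI, rule DERIV_add[OF DERIV_divide[OF DERIV_cmult[OF DERIV_power[OF u_sqrt[OF that]]]
        DERIV_real_sqrt[OF that]] DERIV_mult[OF DERIV_cmult[OF u_sqrt[OF that]] u1_sqrt[OF that]]])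
       (use that in simp)
  then obtain H2 where H2: "\<And>s. s > 0 \<Longrightarrow> (H1 has_real_derivative H2 s) (at s)" by metis
  have "H s > 0" if "s > 0" for s
    unfolding H_def using that by (intro mult_pos_pos zero_less_power assms(5)) auto
  then interpret profile K \<epsilon> H H1 H2
    by unfold_locales (use K assms(6) H_deriv H2 in auto)
  have metric: "total_metric \<epsilon> u gF = (\<lambda>(_, _, i). warped P Q W (gF i))"
    by (simp add: fun_eq_iff total_metric_def warped_def P_def Q_def W_def H_def dim[symmetric] Let_def
        algebra_simps)
  have F: "pseudo_riemannian F gF"
    and ricF: "\<And>i x v w. i \<in> indices F \<Longrightarrow> x \<in> chart_image F i \<Longrightarrow> ricci (gF i) x v w = \<nu> * gF i x v w"
    using assms(3) unfolding einstein_def by blast+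
  have ricci: "ricci (warped P Q W (gF i)) (s, y, x) (a, b, v) (a', b', v') =
      - (H2 s + H1 s / (K * s)) / (2 * H s) * (a * a' + Q s / P s * (b * b'))
      + (\<nu> - s powr (1 / K) * H1 s / K) * gF i x v v'"
    if "i \<in> indices F" "s > 0" "x \<in> chart_image F i" for i s y x a b v a' b' v'
    unfolding ricci_profile[OF pseudo_riemannian_local_metric[OF F that(1)] dim that(2,3)] ricF[OF that(1,3)]
    by (simp add: algebra_simps)
  have "einstein (total_space F) (total_metric \<epsilon> u gF) lam \<longleftrightarrow>
      (\<forall>s>0. H1 s = K * (\<nu> * s powr (- 1 / K) - lam * s powr (1 / K)))"
  proof
    assume E: "einstein (total_space F) (total_metric \<epsilon> u gF) lam"
    \<comment> \<open>Manifolds are nonempty by definition, and one fibre point suffices because the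
      equation sought involves s alone.\<close>
    obtain i x where ix: "i \<in> indices F" "x \<in> chart_image F i"
      using F unfolding pseudo_riemannian_def smooth_manifold_def chart_image_def by blast
    interpret local_metric "chart_image F i" "gF i" by (rule pseudo_riemannian_local_metric[OF F ix(1)])
    \<comment> \<open>A basis vector may be null for an indefinite metric, so \<open>e\<close> is
      paired with some \<open>v\<close> provided by nondegeneracy instead of with itself.\<close>
    obtain e :: 'e where "e \<in> Basis" using nonempty_Basis by blast
    then obtain v where v: "gF i x e v \<noteq> 0" using nondeg[OF ix(2), of e] nonzero_Basis by blast
    show "\<forall>s>0. H1 s = K * (\<nu> * s powr (- 1 / K) - lam * s powr (1 / K))"
    proof (intro allI impI)
      fix s :: real assume "s > 0"
      then have "((), (), i) \<in> indices (total_space F)" "(s, 0, x) \<in> chart_image (total_space F) ((), (), i)"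
        using ix by (simp_all add: indices_total_space)
      \<comment> \<open>On fibre vectors the base terms of both sides vanish, and the nonzero factor
        \<open>gF i x e v\<close> can be cancelled.\<close>
      with E have "ricci (warped P Q W (gF i)) (s, 0, x) (0, 0, e) (0, 0, v) =
          lam * warped P Q W (gF i) (s, 0, x) (0, 0, e) (0, 0, v)"
        unfolding einstein_def metric by fastforce
      then have "\<nu> - s powr (1 / K) * H1 s / K = lam * s powr (2 / K)"
        using v by (simp add: ricci ix \<open>s > 0\<close> W_def)
      then have "s powr (- 1 / K) * (K * (\<nu> - lam * s powr (2 / K))) = s powr (- 1 / K) * (s powr (1 / K) * H1 s)"
        using K by (simp add: field_simps)
      also have "\<dots> = H1 s"
        using powr_inverse_cancel(1)[OF \<open>s > 0\<close>, of K] by (simp add: mult.left_commute mult.assoc[symmetric])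
      finally have "H1 s = K * (\<nu> * s powr (- 1 / K) - lam * (s powr (- 1 / K) * s powr (2 / K)))"
        by (simp add: algebra_simps)
      then show "H1 s = K * (\<nu> * s powr (- 1 / K) - lam * s powr (1 / K))"
        unfolding powr_inverse_cancel(3)[OF \<open>s > 0\<close>] .
    qed
  next
    assume ode: "\<forall>s>0. H1 s = K * (\<nu> * s powr (- 1 / K) - lam * s powr (1 / K))"
    then obtain C where C: "\<And>s. s > 0 \<Longrightarrow> H s = \<Phi> K \<nu> lam s + C"
      using ode_iff[OF K H_deriv, of \<nu> lam] by blast
    \<comment> \<open>The equation has been integrated first so that smoothness of \<open>H\<close>
      can be read off from its explicit solution, without composing \<open>u\<close> with the square
      root.\<close>
    have H_smooth: "Ck_on n {0<..} H" for n
      by (rule Ck_on_cong[OF open_greaterThan _ Ck_on_add[OF open_greaterThan \<Phi>_smooth Ck_on_const[OF open_greaterThan]]])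
         (simp add: C)
    have "Ck_on n {0<..} (\<lambda>s. s powr (1 / K - 1) * inverse (H s))" for n
      by (intro Ck_on_mult Ck_on_powr Ck_on_inverse H_smooth open_greaterThan) (use H_pos in force)
    then have "smooth_on {0<..} P" unfolding smooth_on_def P_def divide_inverse[of "_ powr _"] by blast
    moreover have "smooth_on {0<..} Q"
      unfolding smooth_on_def Q_def
      by (intro allI Ck_on_mult Ck_on_powr Ck_on_const H_smooth open_greaterThan)
    moreover have "smooth_on {0<..} W"
      unfolding smooth_on_def W_def by (intro allI Ck_on_powr)
    ultimately have "pseudo_riemannian (total_space F) (total_metric \<epsilon> u gF)"
      unfolding metric by (intro pseudo_riemannian_warped F nonzero)
    moreover have "ricci (warped P Q W (gF i)) (s, y, x) (a, b, v) (a', b', v') =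
        lam * warped P Q W (gF i) (s, y, x) (a, b, v) (a', b', v')"
      if "i \<in> indices F" "s > 0" "x \<in> chart_image F i" for i s y x a b v a' b' v'
    proof -
      \<comment> \<open>This settles both base directions: the y term carries the same coefficient
        times \<open>Q s / P s\<close>, and lam P (Q / P) = lam Q.\<close>
      have c1: "- (H2 s + H1 s / (K * s)) / (2 * H s) = lam * P s"
        using ode_derivative[of K s H1 \<nu> lam H2, OF K that(2) _ H2[OF that(2)]] ode by (simp add: P_def)
      have c2: "s powr (1 / K) * H1 s / K = \<nu> - lam * W s"
      proof -
        have H1_eq: "H1 s = K * (\<nu> * s powr (- 1 / K) - lam * s powr (1 / K))"
          using ode that(2) by blast
        have "s powr (1 / K) * H1 s / K =
            \<nu> * (s powr (1 / K) * s powr (- 1 / K)) - lam * (s powr (1 / K) * s powr (1 / K))"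
          unfolding H1_eq using K by (simp add: field_simps)
        then show ?thesis unfolding powr_inverse_cancel(1,2)[OF that(2)] W_def by simp
      qed
      show ?thesis
        unfolding ricci[OF that] c1 c2 warped_simp using nonzero(1)[OF that(2)] by (simp add: algebra_simps)
    qed
    ultimately show "einstein (total_space F) (total_metric \<epsilon> u gF) lam"
      unfolding einstein_def metric by (auto simp: indices_total_space)
  qed
  also have "\<dots> \<longleftrightarrow> (\<exists>C. \<forall>s>0. 4 * sqrt s * (u (sqrt s))\<^sup>2 = \<Phi> K \<nu> lam s + C)"
    using ode_iff[OF K H_deriv] by (simp add: H_def)
  finally show ?thesis
    using solution_iff[OF K, of u lam \<nu>] unfolding K_def by simp
qed

end
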